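(* Let $\Bbbk$ be a field of characteristic different from $2$ and let $n\ge 2$. For each of the triangular structures $\mathcal{R}_a$ ($a\in\Bbbk$, $q\in\{0,1\}$) on $A_{C_2^n}$ described in the context, and for every $\alpha\in\Bbbk$, the element $\alpha\,x\otimes xg$ is an infinitesimal $\mathcal{R}$-matrix for $(A_{C_2^n},\mathcal{R}_a)$.
   Context: $A_{C_2\times C_2}$ is the $8$-dimensional Hopf algebra generated as an algebra by $g,h,x$ with relations $g^2=h^2=1$, $x^2=0$, $gh=hg$, $gx=-xg$, $hx=-xh$, comultiplication $\Delta(g)=g\otimes g$, $\Delta(h)=h\otimes h$, $\Delta(x)=1\otimes x+x\otimes g$, counit $\varepsilon(g)=\varepsilon(h)=1$, $\varepsilon(x)=0$, antipode $S(g)=g$, $S(h)=h$, $S(x)=-xg$. For $n\ge 2$, $A_{C_2^n}$ is the $2^{n+1}$-dimensional Hopf algebra with coradical $\Bbbk C_2^n$ which is isomorphic to (Sweedler's $4$-dimensional Hopf algebra) $\otimes\,\Bbbk C_2^{n-1}$; equivalently, $A_{C_2^n}\cong A_{C_2\times C_2}\otimes\Bbbk C_2^{n-2}$ as Hopf algebras, via an isomorphism identifying $a\otimes 1$ with $a$ for all $a\in A_{C_2\times C_2}$. Thus $A_{C_2\times C_2}$ is regarded as a Hopf subalgebra of $A_{C_2^n}$, and $g,h,x$ as elements of $A_{C_2^n}$. The triangular structures considered on $A_{C_2^n}$ are $$\mathcal{R}_a=\mathcal{R}_q(1\otimes 1+a\,x\otimes gx),\quad a\in\Bbbk,\ q\in\{0,1\},\qquad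 \mathcal{R}_q=\tfrac14\sum_{i,j,k,l=0}^{1}(-1)^{-ij-kl}\,g^ih^k\otimes g^{\,j+q(j+l)}h^{\,q(j+l)}.$$ For a bialgebra $H$ and $T=\sum_i T^i\otimes T_i\in H\otimes H$ write $T_{12}=T\otimes 1$, $T_{23}=1\otimes T$, $T_{13}=\sum_i T^i\otimes 1\otimes T_i$. For a quasitriangular bialgebra $(H,\mathcal{R})$, an infinitesimal $\mathcal{R}$-matrix is $\chi\in H\otimes H$ such that $\chi\Delta(h)=\Delta(h)\chi$ for all $h\in H$, $(\mathrm{Id}\otimes\Delta)(\chi)=\chi_{12}+\mathcal{R}_{12}^{-1}\chi_{13}\mathcal{R}_{12}$, and $(\Delta\otimes\mathrm{Id})(\chi)=\chi_{23}+\mathcal{R}_{23}^{-1}\chi_{13}\mathcal{R}_{23}$. *)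

theory Defs
  imports Complex_Main "HOL-Library.Poly_Mapping" "HOL-Library.Z2"
begin

section \<open>Algebras, bialgebras and Hopf algebras on a vector space with a chosen basis\<close>

text \<open>
  The vector space with basis \<open>B\<close> over the field \<open>'k\<close> is the set of those finitely supported
  functions \<open>'b \<Rightarrow>\<^sub>0 'k\<close> whose support lies in \<open>B\<close>.  The tensor product of the spaces with bases
  \<open>B\<close> and \<open>C\<close> is the space with basis \<open>B \<times> C\<close>.  Linear maps are given by their values on the basis.
\<close>

definition smul :: "'k::field \<Rightarrow> ('b \<Rightarrow>\<^sub>0 'k) \<Rightarrow> ('b \<Rightarrow>\<^sub>0 'k)" (infixr "\<odot>" 75) where
  "c \<odot> v = Poly_Mapping.map (\<lambda>t. c * t) v"

definition bvec :: "'b \<Rightarrow> ('b \<Rightarrow>\<^sub>0 'k::field)" where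
  "bvec b = Poly_Mapping.single b 1"

definition lin :: "('b \<Rightarrow> ('c \<Rightarrow>\<^sub>0 'k)) \<Rightarrow> ('b \<Rightarrow>\<^sub>0 'k::field) \<Rightarrow> ('c \<Rightarrow>\<^sub>0 'k)" where
  "lin f v = (\<Sum>b\<in>Poly_Mapping.keys v. Poly_Mapping.lookup v b \<odot> f b)"

definition tens :: "('b \<Rightarrow>\<^sub>0 'k::field) \<Rightarrow> ('c \<Rightarrow>\<^sub>0 'k) \<Rightarrow> ('b \<times> 'c \<Rightarrow>\<^sub>0 'k)" (infixr "\<otimes>" 72) where
  "u \<otimes> v = lin (\<lambda>b. lin (\<lambda>c. bvec (b, c)) v) u"

text \<open>For \<open>f\<close> and \<open>f'\<close> given on the basis, the linear map \<open>f \<otimes> f'\<close>.\<close>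

definition tmap ::
  "('b \<Rightarrow> ('d \<Rightarrow>\<^sub>0 'k)) \<Rightarrow> ('c \<Rightarrow> ('e \<Rightarrow>\<^sub>0 'k)) \<Rightarrow> ('b \<times> 'c \<Rightarrow>\<^sub>0 'k::field) \<Rightarrow> ('d \<times> 'e \<Rightarrow>\<^sub>0 'k)" where
  "tmap f f' = lin (\<lambda>(b, c). f b \<otimes> f' c)"

definition flip :: "('b \<times> 'c \<Rightarrow>\<^sub>0 'k::field) \<Rightarrow> ('c \<times> 'b \<Rightarrow>\<^sub>0 'k)" where
  "flip = lin (\<lambda>(b, c). bvec (c, b))"

text \<open>Threefold tensor products are always bracketed to the right.\<close>

definition reassoc :: "(('b \<times> 'c) \<times> 'd \<Rightarrow>\<^sub>0 'k::field) \<Rightarrow> ('b \<times> 'c \<times> 'd \<Rightarrow>\<^sub>0 'k)" where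
  "reassoc = lin (\<lambda>((b, c), d). bvec (b, c, d))"

record (overloaded) ('b, 'k) alg_data =
  Basis :: "'b set"
  bmult :: "'b \<Rightarrow> 'b \<Rightarrow> ('b \<Rightarrow>\<^sub>0 'k)"
  unit_el :: "'b \<Rightarrow>\<^sub>0 'k"

record (overloaded) ('b, 'k) hopf_data = "('b, 'k) alg_data" +
  bcomult :: "'b \<Rightarrow> ('b \<times> 'b \<Rightarrow>\<^sub>0 'k)"
  bcounit :: "'b \<Rightarrow> 'k"
  bantipode :: "'b \<Rightarrow> ('b \<Rightarrow>\<^sub>0 'k)"

definition vecs :: "('b, 'k::field, 'z) alg_data_scheme \<Rightarrow> ('b \<Rightarrow>\<^sub>0 'k) set" where
  "vecs A = {v. Poly_Mapping.keys v \<subseteq> Basis A}"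

definition amult ::
  "('b, 'k::field, 'z) alg_data_scheme \<Rightarrow> ('b \<Rightarrow>\<^sub>0 'k) \<Rightarrow> ('b \<Rightarrow>\<^sub>0 'k) \<Rightarrow> ('b \<Rightarrow>\<^sub>0 'k)" where
  "amult A u v = lin (\<lambda>b. lin (bmult A b) v) u"

fun apow :: "('b, 'k::field, 'z) alg_data_scheme \<Rightarrow> ('b \<Rightarrow>\<^sub>0 'k) \<Rightarrow> nat \<Rightarrow> ('b \<Rightarrow>\<^sub>0 'k)" where
  "apow A u 0 = unit_el A"
| "apow A u (Suc m) = amult A (apow A u m) u"

definition comult :: "('b, 'k::field) hopf_data \<Rightarrow> ('b \<Rightarrow>\<^sub>0 'k) \<Rightarrow> ('b \<times> 'b \<Rightarrow>\<^sub>0 'k)" where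
  "comult H = lin (bcomult H)"

definition counit :: "('b, 'k::field) hopf_data \<Rightarrow> ('b \<Rightarrow>\<^sub>0 'k) \<Rightarrow> 'k" where
  "counit H v = (\<Sum>b\<in>Poly_Mapping.keys v. Poly_Mapping.lookup v b * bcounit H b)"

definition tensor_alg ::
  "('b, 'k::field, 'y) alg_data_scheme \<Rightarrow> ('c, 'k, 'z) alg_data_scheme \<Rightarrow> ('b \<times> 'c, 'k) alg_data" where
  "tensor_alg A B =
     \<lparr>Basis = Basis A \<times> Basis B,
      bmult = (\<lambda>(b, c) (b', c'). bmult A b b' \<otimes> bmult B c c'),
      unit_el = unit_el A \<otimes> unit_el B\<rparr>"

definition is_algebra :: "('b, 'k::field, 'z) alg_data_scheme \<Rightarrow> bool" where
  "is_algebra A \<longleftrightarrow>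
     unit_el A \<in> vecs A \<and>
     (\<forall>u\<in>vecs A. \<forall>v\<in>vecs A. amult A u v \<in> vecs A) \<and>
     (\<forall>u\<in>vecs A. \<forall>v\<in>vecs A. \<forall>w\<in>vecs A.
        amult A (amult A u v) w = amult A u (amult A v w)) \<and>
     (\<forall>v\<in>vecs A. amult A (unit_el A) v = v \<and> amult A v (unit_el A) = v)"

definition id_tens_comult :: "('b, 'k::field) hopf_data \<Rightarrow> ('b \<times> 'b \<Rightarrow>\<^sub>0 'k) \<Rightarrow> ('b \<times> 'b \<times> 'b \<Rightarrow>\<^sub>0 'k)" where
  "id_tens_comult H = tmap bvec (bcomult H)"

definition comult_tens_id :: "('b, 'k::field) hopf_data \<Rightarrow> ('b \<times> 'b \<Rightarrow>\<^sub>0 'k) \<Rightarrow> ('b \<times> 'b \<times> 'b \<Rightarrow>\<^sub>0 'k)" where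
  "comult_tens_id H T = reassoc (tmap (bcomult H) bvec T)"

definition is_coalgebra :: "('b, 'k::field) hopf_data \<Rightarrow> bool" where
  "is_coalgebra H \<longleftrightarrow>
     (\<forall>v\<in>vecs H. comult H v \<in> vecs (tensor_alg H H) \<and>
        comult_tens_id H (comult H v) = id_tens_comult H (comult H v) \<and>
        lin (\<lambda>(b, c). bcounit H b \<odot> bvec c) (comult H v) = v \<and>
        lin (\<lambda>(b, c). bcounit H c \<odot> bvec b) (comult H v) = v)"

definition is_bialgebra :: "('b, 'k::field) hopf_data \<Rightarrow> bool" where
  "is_bialgebra H \<longleftrightarrow> is_algebra H \<and> is_coalgebra H \<and>
     comult H (unit_el H) = unit_el H \<otimes> unit_el H \<and> counit H (unit_el H) = 1 \<and>
     (\<forall>u\<in>vecs H. \<forall>v\<in>vecs H.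
        comult H (amult H u v) = amult (tensor_alg H H) (comult H u) (comult H v) \<and>
        counit H (amult H u v) = counit H u * counit H v)"

definition is_hopf_algebra :: "('b, 'k::field) hopf_data \<Rightarrow> bool" where
  "is_hopf_algebra H \<longleftrightarrow> is_bialgebra H \<and>
     (\<forall>v\<in>vecs H. lin (bantipode H) v \<in> vecs H \<and>
        lin (\<lambda>(b, c). amult H (bantipode H b) (bvec c)) (comult H v) = counit H v \<odot> unit_el H \<and>
        lin (\<lambda>(b, c). amult H (bvec b) (bantipode H c)) (comult H v) = counit H v \<odot> unit_el H)"

definition tensor_hopf ::
  "('b, 'k::field) hopf_data \<Rightarrow> ('c, 'k) hopf_data \<Rightarrow> ('b \<times> 'c, 'k) hopf_data" where
  "tensor_hopf H K = alg_data.extend (tensor_alg H K) (hopf_data.fields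
     (\<lambda>(b, c). lin (\<lambda>((b1, b2), (c1, c2)). bvec ((b1, c1), (b2, c2))) (bcomult H b \<otimes> bcomult K c))
     (\<lambda>(b, c). bcounit H b * bcounit K c)
     (\<lambda>(b, c). bantipode H b \<otimes> bantipode K c))"


section \<open>Quasitriangular bialgebras and infinitesimal R-matrices\<close>

definition ainvertible :: "('b, 'k::field, 'z) alg_data_scheme \<Rightarrow> ('b \<Rightarrow>\<^sub>0 'k) \<Rightarrow> bool" where
  "ainvertible A u \<longleftrightarrow>
     u \<in> vecs A \<and> (\<exists>v\<in>vecs A. amult A u v = unit_el A \<and> amult A v u = unit_el A)"

definition ainv :: "('b, 'k::field, 'z) alg_data_scheme \<Rightarrow> ('b \<Rightarrow>\<^sub>0 'k) \<Rightarrow> ('b \<Rightarrow>\<^sub>0 'k)" where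
  "ainv A u = (THE v. v \<in> vecs A \<and> amult A u v = unit_el A \<and> amult A v u = unit_el A)"

definition tensor2 :: "('b, 'k::field) hopf_data \<Rightarrow> ('b \<times> 'b, 'k) alg_data" where
  "tensor2 H = tensor_alg H H"

definition tensor3 :: "('b, 'k::field) hopf_data \<Rightarrow> ('b \<times> 'b \<times> 'b, 'k) alg_data" where
  "tensor3 H = tensor_alg H (tensor_alg H H)"

definition leg12 :: "('b, 'k::field) hopf_data \<Rightarrow> ('b \<times> 'b \<Rightarrow>\<^sub>0 'k) \<Rightarrow> ('b \<times> 'b \<times> 'b \<Rightarrow>\<^sub>0 'k)" where
  "leg12 H T = reassoc (T \<otimes> unit_el H)"

definition leg23 :: "('b, 'k::field) hopf_data \<Rightarrow> ('b \<times> 'b \<Rightarrow>\<^sub>0 'k) \<Rightarrow> ('b \<times> 'b \<times> 'b \<Rightarrow>\<^sub>0 'k)" where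
  "leg23 H T = unit_el H \<otimes> T"

definition leg13 :: "('b, 'k::field) hopf_data \<Rightarrow> ('b \<times> 'b \<Rightarrow>\<^sub>0 'k) \<Rightarrow> ('b \<times> 'b \<times> 'b \<Rightarrow>\<^sub>0 'k)" where
  "leg13 H T = lin (\<lambda>(b, c). bvec b \<otimes> unit_el H \<otimes> bvec c) T"

definition quasitriangular_bialgebra :: "('b, 'k::field) hopf_data \<Rightarrow> ('b \<times> 'b \<Rightarrow>\<^sub>0 'k) \<Rightarrow> bool" where
  "quasitriangular_bialgebra H R \<longleftrightarrow> is_bialgebra H \<and> ainvertible (tensor2 H) R \<and>
     (\<forall>v\<in>vecs H. amult (tensor2 H) R (comult H v) = amult (tensor2 H) (flip (comult H v)) R) \<and>
     id_tens_comult H R = amult (tensor3 H) (leg13 H R) (leg12 H R) \<and>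
     comult_tens_id H R = amult (tensor3 H) (leg13 H R) (leg23 H R)"

definition infinitesimal_R_matrix ::
  "('b, 'k::field) hopf_data \<Rightarrow> ('b \<times> 'b \<Rightarrow>\<^sub>0 'k) \<Rightarrow> ('b \<times> 'b \<Rightarrow>\<^sub>0 'k) \<Rightarrow> bool" where
  "infinitesimal_R_matrix H R \<chi> \<longleftrightarrow> quasitriangular_bialgebra H R \<and> \<chi> \<in> vecs (tensor2 H) \<and>
     (\<forall>v\<in>vecs H. amult (tensor2 H) \<chi> (comult H v) = amult (tensor2 H) (comult H v) \<chi>) \<and>
     id_tens_comult H \<chi> = leg12 H \<chi> +
       amult (tensor3 H) (amult (tensor3 H) (ainv (tensor3 H) (leg12 H R)) (leg13 H \<chi>)) (leg12 H R) \<and>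
     comult_tens_id H \<chi> = leg23 H \<chi> +
       amult (tensor3 H) (amult (tensor3 H) (ainv (tensor3 H) (leg23 H R)) (leg13 H \<chi>)) (leg23 H R)"


section \<open>The Hopf algebras \<open>A\<^bsub>C\<^sub>2\<times>C\<^sub>2\<^esub>\<close> and \<open>A\<^bsub>C\<^sub>2\<^sup>n\<^esub>\<close>\<close>

text \<open>
  \<open>A\<^bsub>C\<^sub>2\<times>C\<^sub>2\<^esub>\<close> is realised on its monomial basis: \<open>(i, j, e)\<close> with \<open>i, j, e \<in> {0, 1}\<close> stands for
  \<open>g\<^sup>i h\<^sup>j x\<^sup>e\<close>.  Moving \<open>x\<^sup>e\<close> past \<open>g\<^bsup>i'\<^esup> h\<^bsup>j'\<^esup>\<close> costs the sign \<open>(-1)\<^bsup>e(i'+j')\<^esup>\<close>.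
  That this is the algebra presented by the generators \<open>g, h, x\<close> and the relations
  \<open>g\<^sup>2 = h\<^sup>2 = 1, x\<^sup>2 = 0, gh = hg, gx = -xg, hx = -xh\<close> is shown by \<open>A22_relations\<close>, \<open>A22_monomial\<close>
  and \<open>A22_universal\<close> below.
\<close>

definition A22_alg :: "(nat \<times> nat \<times> nat, 'k::field) alg_data" where
  "A22_alg =
     \<lparr>Basis = {0, 1} \<times> {0, 1} \<times> {0, 1},
      bmult = (\<lambda>(i, j, e) (i', j', e').
        if e + e' \<le> 1
        then (- 1) ^ (e * (i' + j')) \<odot> bvec ((i + i') mod 2, (j + j') mod 2, e + e') else 0),
      unit_el = bvec (0, 0, 0)\<rparr>"

definition g22 :: "nat \<times> nat \<times> nat \<Rightarrow>\<^sub>0 'k::field" where "g22 = bvec (1, 0, 0)"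
definition h22 :: "nat \<times> nat \<times> nat \<Rightarrow>\<^sub>0 'k::field" where "h22 = bvec (0, 1, 0)"
definition x22 :: "nat \<times> nat \<times> nat \<Rightarrow>\<^sub>0 'k::field" where "x22 = bvec (0, 0, 1)"

text \<open>
  The comultiplication is the multiplicative and the antipode the antimultiplicative extension of
  \<open>\<Delta>(g) = g \<otimes> g\<close>, \<open>\<Delta>(h) = h \<otimes> h\<close>, \<open>\<Delta>(x) = 1 \<otimes> x + x \<otimes> g\<close> and
  \<open>S(g) = g\<close>, \<open>S(h) = h\<close>, \<open>S(x) = -xg\<close>.
\<close>

definition A22 :: "(nat \<times> nat \<times> nat, 'k::field) hopf_data" where
  "A22 = alg_data.extend A22_alg (hopf_data.fields
     (\<lambda>(i, j, e). amult (tensor_alg A22_alg A22_alg)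
        (amult (tensor_alg A22_alg A22_alg)
          (apow (tensor_alg A22_alg A22_alg) (g22 \<otimes> g22) i)
          (apow (tensor_alg A22_alg A22_alg) (h22 \<otimes> h22) j))
        (apow (tensor_alg A22_alg A22_alg) (unit_el A22_alg \<otimes> x22 + x22 \<otimes> g22) e))
     (\<lambda>(i, j, e). 1 ^ i * 1 ^ j * 0 ^ e)
     (\<lambda>(i, j, e). amult A22_alg
        (amult A22_alg (apow A22_alg (- amult A22_alg x22 g22) e) (apow A22_alg h22 j))
        (apow A22_alg g22 i)))"

definition group_hopf :: "'a::group_add set \<Rightarrow> ('a, 'k::field) hopf_data" where
  "group_hopf G =
     \<lparr>Basis = G, bmult = (\<lambda>a b. bvec (a + b)), unit_el = bvec 0,
      bcomult = (\<lambda>a. bvec (a, a)), bcounit = (\<lambda>a. 1), bantipode = (\<lambda>a. bvec (- a))\<rparr>"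

text \<open>\<open>C\<^sub>2\<^sup>m\<close>, written additively: the functions from \<open>{..<m}\<close> to the integers modulo 2.\<close>

definition C2_power :: "nat \<Rightarrow> (nat \<Rightarrow>\<^sub>0 bit) set" where
  "C2_power m = {v. Poly_Mapping.keys v \<subseteq> {..<m}}"

text \<open>This is \<open>A\<^bsub>C\<^sub>2\<^sup>n\<^esub>\<close> for \<open>n \<ge> 2\<close>.\<close>

definition A_C2 :: "nat \<Rightarrow> ((nat \<times> nat \<times> nat) \<times> (nat \<Rightarrow>\<^sub>0 bit), 'k::field) hopf_data" where
  "A_C2 n = tensor_hopf A22 (group_hopf (C2_power (n - 2)))"

definition A22_incl :: "(nat \<times> nat \<times> nat \<Rightarrow>\<^sub>0 'k::field) \<Rightarrow> ((nat \<times> nat \<times> nat) \<times> (nat \<Rightarrow>\<^sub>0 bit) \<Rightarrow>\<^sub>0 'k)" where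
  "A22_incl a = a \<otimes> bvec 0"

definition gC :: "(nat \<times> nat \<times> nat) \<times> (nat \<Rightarrow>\<^sub>0 bit) \<Rightarrow>\<^sub>0 'k::field" where "gC = A22_incl g22"
definition hC :: "(nat \<times> nat \<times> nat) \<times> (nat \<Rightarrow>\<^sub>0 bit) \<Rightarrow>\<^sub>0 'k::field" where "hC = A22_incl h22"
definition xC :: "(nat \<times> nat \<times> nat) \<times> (nat \<Rightarrow>\<^sub>0 bit) \<Rightarrow>\<^sub>0 'k::field" where "xC = A22_incl x22"

definition Rq :: "nat \<Rightarrow> nat \<Rightarrow>
    (((nat \<times> nat \<times> nat) \<times> (nat \<Rightarrow>\<^sub>0 bit)) \<times> ((nat \<times> nat \<times> nat) \<times> (nat \<Rightarrow>\<^sub>0 bit)) \<Rightarrow>\<^sub>0 'k::field)" where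
  "Rq n q = (1 / 4) \<odot> (\<Sum>i\<in>{0..1}. \<Sum>j\<in>{0..1}. \<Sum>k\<in>{0..1}. \<Sum>l\<in>{0..1}.
     (- 1) powi (- int (i * j) - int (k * l)) \<odot>
       (amult (A_C2 n) (apow (A_C2 n) gC i) (apow (A_C2 n) hC k) \<otimes>
        amult (A_C2 n) (apow (A_C2 n) gC (j + q * (j + l))) (apow (A_C2 n) hC (q * (j + l)))))"

definition Ra :: "nat \<Rightarrow> nat \<Rightarrow> 'k \<Rightarrow>
    (((nat \<times> nat \<times> nat) \<times> (nat \<Rightarrow>\<^sub>0 bit)) \<times> ((nat \<times> nat \<times> nat) \<times> (nat \<Rightarrow>\<^sub>0 bit)) \<Rightarrow>\<^sub>0 'k::field)" where
  "Ra n q a = amult (tensor2 (A_C2 n)) (Rq n q)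
     (unit_el (A_C2 n) \<otimes> unit_el (A_C2 n) + a \<odot> (xC \<otimes> amult (A_C2 n) gC xC))"


section \<open>Correctness of the model\<close>

lemma lookup_smul [simp]: "Poly_Mapping.lookup (c \<odot> v) b = c * Poly_Mapping.lookup v b"
  by (simp add: smul_def Poly_Mapping.map.rep_eq when_def)

lemma smul_simps [simp]:
  "c \<odot> d \<odot> v = (c * d) \<odot> v" "1 \<odot> v = v" "0 \<odot> v = 0" "c \<odot> 0 = 0" "(- c) \<odot> v = - (c \<odot> v)" "c \<odot> (- v) = - (c \<odot> v)"
  by (auto intro!: poly_mapping_eqI)

lemma smul_add: "c \<odot> (u + v) = c \<odot> u + c \<odot> v" "(c + d) \<odot> v = c \<odot> v + d \<odot> v"
  by (auto intro!: poly_mapping_eqI simp: lookup_add algebra_simps)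

lemma smul_sum: "c \<odot> sum f S = (\<Sum>s\<in>S. c \<odot> f s)"
  by (induction S rule: infinite_finite_induct) (auto simp: smul_add)

lemma lin_superset:
  assumes "finite S" "Poly_Mapping.keys v \<subseteq> S"
  shows "lin f v = (\<Sum>b\<in>S. Poly_Mapping.lookup v b \<odot> f b)"
  unfolding lin_def by (rule sum.mono_neutral_left) (use assms in \<open>auto simp: in_keys_iff\<close>)

lemma lin_zero [simp]: "lin f 0 = 0" by (simp add: lin_def)

lemma lin_add: "lin f (u + v) = lin f u + lin f v"
proof -
  let ?S = "Poly_Mapping.keys u \<union> Poly_Mapping.keys v"
  have "finite ?S" by simp
  then show ?thesis
    using keys_add[of u v]
    by (simp add: lin_superset[of ?S] lookup_add smul_add sum.distrib)
qed

lemma lin_smul: "lin f (c \<odot> v) = c \<odot> lin f v"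
proof -
  have "Poly_Mapping.keys (c \<odot> v) \<subseteq> Poly_Mapping.keys v" by (auto simp: in_keys_iff)
  then show ?thesis
    by (simp add: lin_superset[of "Poly_Mapping.keys v"] smul_sum)
qed

lemma lin_uminus: "lin f (- v) = - lin f v"
  using lin_smul[of f "-1" v] by simp

lemma lin_sum: "lin f (sum g S) = (\<Sum>s\<in>S. lin f (g s))"
  by (induction S rule: infinite_finite_induct) (auto simp: lin_add)

lemma lin_bvec [simp]: "lin f (bvec b) = f b"
  by (simp add: lin_def bvec_def)

lemma lin_lin: "lin f (lin g v) = lin (\<lambda>b. lin f (g b)) v"
  unfolding lin_def[of g v] lin_def[of "\<lambda>b. lin f (g b)" v] by (simp add: lin_sum lin_smul)

lemma lin_cong: "(\<And>b. b \<in> Poly_Mapping.keys v \<Longrightarrow> f b = g b) \<Longrightarrow> lin f v = lin g v"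
  by (simp add: lin_def)

lemma lin_fun:
  "lin (\<lambda>b. f b + g b) v = lin f v + lin g v" "lin (\<lambda>b. c \<odot> f b) v = c \<odot> lin f v"
  "lin (\<lambda>b. 0) v = 0"
  by (simp_all add: lin_def smul_add sum.distrib smul_sum mult.commute)

lemma lin_swap: "lin (\<lambda>b. lin (\<lambda>c. f b c) v) u = lin (\<lambda>c. lin (\<lambda>b. f b c) u) v"
  by (simp add: lin_def smul_sum mult.commute) (rule sum.swap)

lemma lin_bvec_id: "lin bvec v = v"
proof (rule poly_mapping_eqI)
  fix k
  have "Poly_Mapping.lookup (lin bvec v) k =
     (\<Sum>b\<in>Poly_Mapping.keys v. if b = k then Poly_Mapping.lookup v b else 0)"
    by (simp add: lin_def lookup_sum bvec_def lookup_single when_def if_distrib cong: if_cong)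
  then show "Poly_Mapping.lookup (lin bvec v) k = Poly_Mapping.lookup v k"
    by (simp add: in_keys_iff)
qed

lemma vecs_0: "0 \<in> vecs A" by (simp add: vecs_def)
lemma vecs_bvec: "bvec b \<in> vecs A \<longleftrightarrow> b \<in> Basis A" by (simp add: vecs_def bvec_def)
lemma vecs_add: "u \<in> vecs A \<Longrightarrow> v \<in> vecs A \<Longrightarrow> u + v \<in> vecs A"
  using keys_add[of u v] by (auto simp: vecs_def)
lemma vecs_smul: "v \<in> vecs A \<Longrightarrow> c \<odot> v \<in> vecs A"
  by (fastforce simp: vecs_def in_keys_iff)
lemma vecs_uminus: "- v \<in> vecs A \<longleftrightarrow> v \<in> vecs A"
  using vecs_smul[of v A "-1"] vecs_smul[of "- v" A "-1"] by auto
lemma vecs_sum: "(\<And>s. s \<in> S \<Longrightarrow> f s \<in> vecs A) \<Longrightarrow> sum f S \<in> vecs A"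
  by (induction S rule: infinite_finite_induct) (auto simp: vecs_0 vecs_add)
lemma vecs_lin: "v \<in> vecs B \<Longrightarrow> (\<And>b. b \<in> Basis B \<Longrightarrow> f b \<in> vecs A) \<Longrightarrow> lin f v \<in> vecs A"
  unfolding lin_def by (intro vecs_sum vecs_smul) (auto simp: vecs_def)
lemma lin_cong_vecs: "v \<in> vecs A \<Longrightarrow> (\<And>b. b \<in> Basis A \<Longrightarrow> f b = g b) \<Longrightarrow> lin f v = lin g v"
  by (rule lin_cong) (auto simp: vecs_def)

lemma tens_lin:
  "(u + v) \<otimes> w = u \<otimes> w + v \<otimes> w" "w \<otimes> (u' + v') = w \<otimes> u' + w \<otimes> v'"
  "(c \<odot> u) \<otimes> w = c \<odot> (u \<otimes> w)" "u \<otimes> (c \<odot> w) = c \<odot> (u \<otimes> w)"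
  "(- u) \<otimes> w = - (u \<otimes> w)" "u \<otimes> (- w) = - (u \<otimes> w)"
  "0 \<otimes> w = 0" "u \<otimes> 0 = 0"
  "bvec b \<otimes> bvec b' = bvec (b, b')"
proof -
  show 1: "(c \<odot> u) \<otimes> w = c \<odot> (u \<otimes> w)" "u \<otimes> (c \<odot> w) = c \<odot> (u \<otimes> w)" for c
    by (simp_all add: tens_def lin_smul lin_fun)
  show "(- u) \<otimes> w = - (u \<otimes> w)" "u \<otimes> (- w) = - (u \<otimes> w)"
    using 1(1)[of "-1"] 1(2)[of "-1"] by simp_all
qed (simp_all add: tens_def lin_add lin_fun)

lemma amult_lin:
  "amult A (u + v) w = amult A u w + amult A v w" "amult A w (u + v) = amult A w u + amult A w v"
  "amult A (c \<odot> u) w = c \<odot> amult A u w" "amult A u (c \<odot> w) = c \<odot> amult A u w"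
  "amult A (- u) w = - amult A u w" "amult A u (- w) = - amult A u w"
  "amult A 0 w = 0" "amult A u 0 = 0"
  "amult A (bvec b) (bvec b') = bmult A b b'"
proof -
  show 1: "amult A (c \<odot> u) w = c \<odot> amult A u w" "amult A u (c \<odot> w) = c \<odot> amult A u w" for c u w
    by (simp_all add: amult_def lin_smul lin_fun)
  show "amult A (- u) w = - amult A u w" "amult A u (- w) = - amult A u w"
    using 1(1)[of "-1" u w] 1(2)[of u "-1" w] by simp_all
qed (simp_all add: amult_def lin_add lin_fun)

lemma A22_alg_simps [simp]:
  "Basis A22_alg = {0, 1} \<times> {0, 1} \<times> {0, 1}" "unit_el A22_alg = bvec (0, 0, 0)"
  "bmult A22_alg (i, j, e) (i', j', e') = (if e + e' \<le> 1
     then (- 1) ^ (e * (i' + j')) \<odot> bvec ((i + i') mod 2, (j + j') mod 2, e + e') else 0)"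
  by (simp_all add: A22_alg_def)

lemma A22_relations:
  fixes g h x :: "nat \<times> nat \<times> nat \<Rightarrow>\<^sub>0 'k::field"
  defines "g \<equiv> g22" and "h \<equiv> h22" and "x \<equiv> x22"
  shows "amult A22_alg g g = unit_el A22_alg" "amult A22_alg h h = unit_el A22_alg"
    "amult A22_alg x x = 0" "amult A22_alg g h = amult A22_alg h g"
    "amult A22_alg g x = - amult A22_alg x g" "amult A22_alg h x = - amult A22_alg x h"
  by (simp_all add: g_def h_def x_def g22_def h22_def x22_def amult_lin)

lemma A22_monomial:
  assumes "i \<in> {0, 1}" "j \<in> {0, 1}" "e \<in> {0, 1}"
  shows "amult A22_alg (amult A22_alg (apow A22_alg g22 i) (apow A22_alg h22 j)) (apow A22_alg x22 e)
    = bvec (i, j, e)"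
  using assms by (auto simp: g22_def h22_def x22_def amult_lin)

text \<open>
  Any three elements of an associative unital algebra (a ring \<open>'r\<close> with a compatible scalar
  multiplication) that satisfy the relations are the images of \<open>g, h, x\<close> under an algebra
  homomorphism, which is unique by \<open>A22_monomial\<close>.
\<close>

lemma A22_universal:
  fixes s :: "'k::field \<Rightarrow> 'r::ring_1 \<Rightarrow> 'r" and G H X :: 'r
  assumes "module s"
    and "\<And>c u v. s c u * v = s c (u * v)" "\<And>c u v. u * s c v = s c (u * v)"
    and "G * G = 1" "H * H = 1" "X * X = 0" "G * H = H * G" "G * X = - (X * G)" "H * X = - (X * H)"
  defines "\<phi> \<equiv> \<lambda>v :: nat \<times> nat \<times> nat \<Rightarrow>\<^sub>0 'k. \<Sum>(i, j, e)\<in>Poly_Mapping.keys v.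
    s (Poly_Mapping.lookup v (i, j, e)) (G ^ i * H ^ j * X ^ e)"
  shows "\<phi> (u + v) = \<phi> u + \<phi> v" "\<phi> (c \<odot> v) = s c (\<phi> v)" "\<phi> (unit_el A22_alg) = 1"
    "u \<in> vecs A22_alg \<Longrightarrow> v \<in> vecs A22_alg \<Longrightarrow> \<phi> (amult A22_alg u v) = \<phi> u * \<phi> v"
    "\<phi> g22 = G" "\<phi> h22 = H" "\<phi> x22 = X"
proof -
  interpret module s by fact
  define m where "m = (\<lambda>(i, j, e). G ^ i * H ^ j * X ^ e :: 'r)"
  have \<phi>: "\<phi> v = (\<Sum>b\<in>S. s (Poly_Mapping.lookup v b) (m b))"
    if "finite S" "Poly_Mapping.keys v \<subseteq> S" for v S
    unfolding \<phi>_def m_def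
    by (subst sum.mono_neutral_left[OF that]) (auto simp: in_keys_iff case_prod_unfold)
  have add: "\<phi> (u + v) = \<phi> u + \<phi> v" for u v
  proof -
    let ?S = "Poly_Mapping.keys u \<union> Poly_Mapping.keys v"
    show ?thesis using keys_add[of u v]
      by (simp add: \<phi>[of ?S] lookup_add scale_left_distrib sum.distrib)
  qed
  have scl: "\<phi> (c \<odot> v) = s c (\<phi> v)" for c v
  proof -
    have "Poly_Mapping.keys (c \<odot> v) \<subseteq> Poly_Mapping.keys v" by (auto simp: in_keys_iff)
    then show ?thesis by (simp add: \<phi>[of "Poly_Mapping.keys v"] scale_sum_right)
  qed
  have zero: "\<phi> 0 = 0" by (simp add: \<phi>_def)
  have sm: "\<phi> (sum f S) = (\<Sum>s\<in>S. \<phi> (f s))" for f and S :: "(nat \<times> nat \<times> nat) set"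
    by (induction S rule: infinite_finite_induct) (auto simp: add zero)
  have bv: "\<phi> (bvec b) = m b" for b
    by (simp add: \<phi>_def bvec_def m_def case_prod_unfold)
  have lin: "\<phi> (lin f v) = (\<Sum>b\<in>Poly_Mapping.keys v. s (Poly_Mapping.lookup v b) (\<phi> (f b)))"
    for f and v :: "nat \<times> nat \<times> nat \<Rightarrow>\<^sub>0 'k"
    by (simp add: lin_def sm scl)
  have uminus: "s (-1) u = - u" for u by (simp add: scale_minus_left)
  have XG: "X * G = - (G * X)" "X * H = - (H * X)" "H * G = G * H" using assms by simp_all
  have ring: "G * (G * u) = u" "H * (H * u) = u" "X * (X * u) = 0" "H * (G * u) = G * (H * u)"
    "X * (G * u) = - (G * (X * u))" "X * (H * u) = - (H * (X * u))" for u
    using assms XG by (simp_all add: mult.assoc[symmetric])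
  have mb: "\<phi> (bmult A22_alg b b') = m b * m b'" if "b \<in> Basis A22_alg" "b' \<in> Basis A22_alg" for b b'
    using that
    by (auto simp: scl zero bv m_def uminus mult.assoc ring XG assms(4-6) simp del: smul_simps)
  show "\<phi> (amult A22_alg u v) = \<phi> u * \<phi> v" if *: "u \<in> vecs A22_alg" "v \<in> vecs A22_alg"
  proof -
    have mb': "\<phi> (bmult A22_alg b c) = m b * m c"
      if "b \<in> Poly_Mapping.keys u" "c \<in> Poly_Mapping.keys v" for b c
      by (rule mb) (use * that in \<open>unfold vecs_def, blast+\<close>)
    have "\<phi> (amult A22_alg u v) = (\<Sum>b\<in>Poly_Mapping.keys u. s (Poly_Mapping.lookup u b)
        (\<Sum>c\<in>Poly_Mapping.keys v. s (Poly_Mapping.lookup v c) (m b * m c)))"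
      unfolding amult_def lin by (intro sum.cong refl arg_cong[of _ _ "s _"] mb')
    also have "\<dots> = \<phi> u * \<phi> v"
      by (simp add: \<phi>[of "Poly_Mapping.keys u" u] \<phi>[of "Poly_Mapping.keys v" v] sum_product
          scale_sum_right assms(2,3) mult.commute)
    finally show ?thesis .
  qed
  show "\<phi> (u + v) = \<phi> u + \<phi> v" "\<phi> (c \<odot> v) = s c (\<phi> v)" by (fact add scl)+
  show "\<phi> (unit_el A22_alg) = 1" "\<phi> g22 = G" "\<phi> h22 = H" "\<phi> x22 = X"
    by (simp_all add: g22_def h22_def x22_def bv m_def)
qed

lemma A_C2_Basis: "Basis (A_C2 n) = ({0, 1} \<times> {0, 1} \<times> {0, 1}) \<times> C2_power (n - 2)"
  by (simp add: A_C2_def tensor_hopf_def tensor_alg_def alg_data.defs hopf_data.defs A22_def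
      A22_alg_def group_hopf_def)

lemma A_C2_unit: "unit_el (A_C2 n) = bvec ((0, 0, 0), 0)"
  by (simp add: A_C2_def tensor_hopf_def tensor_alg_def alg_data.defs hopf_data.defs A22_def
      A22_alg_def group_hopf_def tens_lin)

lemma A_C2_bmult:
  "bmult (A_C2 n) ((i, j, e), p) ((i', j', e'), p') = (if e + e' \<le> 1
     then (- 1) ^ (e * (i' + j')) \<odot> bvec (((i + i') mod 2, (j + j') mod 2, e + e'), p + p') else 0)"
  by (simp add: A_C2_def tensor_hopf_def tensor_alg_def alg_data.defs hopf_data.defs A22_def
      A22_alg_def group_hopf_def tens_lin)

lemma tensor_alg_simps:
  "Basis (tensor_alg A B) = Basis A \<times> Basis B"
  "bmult (tensor_alg A B) (b, c) (b', c') = bmult A b b' \<otimes> bmult B c c'"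
  "unit_el (tensor_alg A B) = unit_el A \<otimes> unit_el B"
  by (simp_all add: tensor_alg_def)

lemma A_C2_bcomult:
  assumes "i \<in> {0, 1}" "j \<in> {0, 1}"
  shows "bcomult (A_C2 n) ((i, j, 0), p) = bvec (((i, j, 0), p), ((i, j, 0), p))"
    "bcomult (A_C2 n) ((i, j, Suc 0), p) = bvec (((i, j, 0), p), ((i, j, 1), p)) +
       bvec (((i, j, 1), p), (((i + 1) mod 2, j, 0), p))"
  using assms
  by (auto simp: A_C2_def tensor_hopf_def tensor_alg_simps alg_data.defs hopf_data.defs A22_def
      group_hopf_def tens_lin amult_lin lin_add g22_def h22_def x22_def)

lemma A_C2_bcounit: "bcounit (A_C2 n) ((i, j, e), p) = 0 ^ e"
  by (simp add: A_C2_def tensor_hopf_def alg_data.defs hopf_data.defs A22_def group_hopf_def)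

lemma A_C2_bantipode:
  assumes "i \<in> {0, 1}" "j \<in> {0, 1}"
  shows "bantipode (A_C2 n) ((i, j, 0), p) = bvec ((i, j, 0), - p)"
    "bantipode (A_C2 n) ((i, j, Suc 0), p) = (- 1) ^ (i + j) \<odot> bvec (((i + 1) mod 2, j, 1), - p)"
  using assms
  by (auto simp: A_C2_def tensor_hopf_def tensor_alg_simps alg_data.defs hopf_data.defs A22_def
      group_hopf_def tens_lin amult_lin lin_add g22_def h22_def x22_def)

lemma C2_power_closed: "0 \<in> C2_power m" "p \<in> C2_power m \<Longrightarrow> q \<in> C2_power m \<Longrightarrow> p + q \<in> C2_power m"
  using keys_add[of p q] by (auto simp: C2_power_def)

lemma C2_power_self: "p + p = 0" "- p = p" for p :: "nat \<Rightarrow>\<^sub>0 bit"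
proof -
  show "p + p = 0" by (rule poly_mapping_eqI) (simp only: lookup_add, simp)
  then show "- p = p" by (simp add: minus_unique)
qed

lemma sign_mod_2 [simp]: "(- 1 :: 'k::field) ^ (m mod 2) = (- 1) ^ m"
  by (metis even_mod_2_iff minus_one_power_iff)

lemma is_algebra_basisI:
  assumes "unit_el A \<in> vecs A"
    and "\<And>b c. b \<in> Basis A \<Longrightarrow> c \<in> Basis A \<Longrightarrow> bmult A b c \<in> vecs A"
    and "\<And>b c d. b \<in> Basis A \<Longrightarrow> c \<in> Basis A \<Longrightarrow> d \<in> Basis A \<Longrightarrow>
      amult A (bmult A b c) (bvec d) = amult A (bvec b) (bmult A c d)"
    and "\<And>b. b \<in> Basis A \<Longrightarrow> amult A (unit_el A) (bvec b) = bvec b"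
    and "\<And>b. b \<in> Basis A \<Longrightarrow> amult A (bvec b) (unit_el A) = bvec b"
  shows "is_algebra A"
proof -
  have *: "amult A u v = lin (\<lambda>b. amult A u (bvec b)) v" for u v
    unfolding amult_def by (subst lin_swap) simp
  have **: "amult A u v = lin (\<lambda>b. amult A (bvec b) v) u" for u v
    unfolding amult_def by simp
  have "amult A u v \<in> vecs A" if "u \<in> vecs A" "v \<in> vecs A" for u v
    unfolding amult_def using that assms(2) by (blast intro: vecs_lin)
  moreover have "amult A (amult A u v) w = amult A u (amult A v w)"
    if "u \<in> vecs A" "v \<in> vecs A" "w \<in> vecs A" for u v w
  proof -
    have "amult A (amult A u v) w = lin (\<lambda>b. lin (\<lambda>c. lin (\<lambda>d. amult A (bmult A b c) (bvec d)) w) v) u"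
      by (subst *) (simp add: amult_def lin_lin lin_swap[of _ w] lin_swap[of _ _ v])
    also have "\<dots> = lin (\<lambda>b. lin (\<lambda>c. lin (\<lambda>d. amult A (bvec b) (bmult A c d)) w) v) u"
      using that assms(3) by (intro lin_cong_vecs[where A = A]) auto
    also have "\<dots> = amult A u (amult A v w)"
      by (simp add: amult_def lin_lin)
    finally show ?thesis .
  qed
  moreover have "amult A (unit_el A) v = v" "amult A v (unit_el A) = v" if "v \<in> vecs A" for v
  proof -
    have "amult A (unit_el A) v = lin bvec v"
      using that assms(4) by (subst *) (auto intro: lin_cong_vecs)
    then show "amult A (unit_el A) v = v" by (simp add: lin_bvec_id)
    have "amult A v (unit_el A) = lin bvec v"
      using that assms(5) by (subst **) (auto intro: lin_cong_vecs)
    then show "amult A v (unit_el A) = v" by (simp add: lin_bvec_id)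
  qed
  ultimately show ?thesis using assms(1) by (auto simp: is_algebra_def)
qed

lemma A_C2_is_algebra: "is_algebra (A_C2 n)"
proof (rule is_algebra_basisI)
  let ?A = "A_C2 n :: (_, 'k::field) hopf_data"
  fix b c d assume "b \<in> Basis ?A" "c \<in> Basis ?A" "d \<in> Basis ?A"
  then obtain i j e p i' j' e' p' i'' j'' e'' p'' where
    *: "b = ((i, j, e), p)" "c = ((i', j', e'), p')" "d = ((i'', j'', e''), p'')"
    "e \<in> {0, 1}" "e' \<in> {0, 1}" "e'' \<in> {0, 1}"
    by (cases b; cases c; cases d) (auto simp: A_C2_Basis)
  show "amult ?A (bmult ?A b c) (bvec d) = amult ?A (bvec b) (bmult ?A c d)"
    unfolding *(1-3) A_C2_bmult using *(4-)
    by (elim insertE emptyE)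
      (simp_all add: amult_lin A_C2_bmult power_add mod_simps ac_simps)
qed (auto simp: A_C2_Basis A_C2_unit A_C2_bmult vecs_bvec C2_power_closed amult_lin
    vecs_0 vecs_uminus intro: vecs_smul)

lemma amult_lin_lin: "amult A (lin f u) (lin g v) = lin (\<lambda>b. lin (\<lambda>c. amult A (f b) (g c)) v) u"
proof -
  have "amult A (lin f u) (lin g v) = lin (\<lambda>b. amult A (f b) (lin g v)) u"
    by (simp add: amult_def lin_lin)
  also have "\<dots> = lin (\<lambda>b. lin (\<lambda>c. amult A (f b) (g c)) v) u"
  proof (rule lin_cong)
    fix b
    show "amult A (f b) (lin g v) = lin (\<lambda>c. amult A (f b) (g c)) v"
      unfolding amult_def by (subst lin_swap) (simp add: lin_lin)
  qed
  finally show ?thesis .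
qed

lemma is_coalgebra_basisI:
  assumes "\<And>b. b \<in> Basis H \<Longrightarrow> bcomult H b \<in> vecs (tensor_alg H H)"
    and "\<And>b. b \<in> Basis H \<Longrightarrow> comult_tens_id H (bcomult H b) = id_tens_comult H (bcomult H b)"
    and "\<And>b. b \<in> Basis H \<Longrightarrow> lin (\<lambda>(b, c). bcounit H b \<odot> bvec c) (bcomult H b) = bvec b"
    and "\<And>b. b \<in> Basis H \<Longrightarrow> lin (\<lambda>(b, c). bcounit H c \<odot> bvec b) (bcomult H b) = bvec b"
  shows "is_coalgebra H"
  unfolding is_coalgebra_def
proof (intro ballI conjI)
  fix v assume v: "v \<in> vecs H"
  show "comult H v \<in> vecs (tensor_alg H H)"
    unfolding comult_def using v assms(1) by (rule vecs_lin)
  show "comult_tens_id H (comult H v) = id_tens_comult H (comult H v)"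
    using lin_cong_vecs[OF v assms(2)]
    by (simp add: comult_tens_id_def id_tens_comult_def comult_def tmap_def reassoc_def lin_lin)
  show "lin (\<lambda>(b, c). bcounit H b \<odot> bvec c) (comult H v) = v"
    "lin (\<lambda>(b, c). bcounit H c \<odot> bvec b) (comult H v) = v"
    using lin_cong_vecs[OF v assms(3)] lin_cong_vecs[OF v assms(4)]
    by (simp_all add: comult_def lin_lin lin_bvec_id)
qed

lemma counit_lin: "counit H v = Poly_Mapping.lookup (lin (\<lambda>b. bcounit H b \<odot> bvec ()) v) ()"
  by (simp add: counit_def lin_def lookup_sum bvec_def)

lemma counit_smul_lin: "counit H v \<odot> u = lin (\<lambda>b. bcounit H b \<odot> u) v"
  by (rule poly_mapping_eqI)
    (simp add: counit_def lin_def lookup_sum sum_distrib_right mult.assoc)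

lemma counit_simps:
  "counit H (u + v) = counit H u + counit H v" "counit H (c \<odot> v) = c * counit H v"
  "counit H (- v) = - counit H v" "counit H 0 = 0" "counit H (bvec b) = bcounit H b"
  by (simp_all add: counit_lin lin_add lin_smul lin_uminus lookup_add) (simp add: bvec_def)

lemma counit_lin_comp:
  "counit H (lin f v) = (\<Sum>b\<in>Poly_Mapping.keys v. Poly_Mapping.lookup v b * counit H (f b))"
  by (simp add: counit_lin lin_lin) (simp add: lin_def lookup_sum)

lemma is_bialgebra_basisI:
  assumes "is_algebra H" "is_coalgebra H"
    and "comult H (unit_el H) = unit_el H \<otimes> unit_el H" "counit H (unit_el H) = 1"
    and "\<And>b c. b \<in> Basis H \<Longrightarrow> c \<in> Basis H \<Longrightarrow>
      comult H (bmult H b c) = amult (tensor_alg H H) (bcomult H b) (bcomult H c)"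
    and "\<And>b c. b \<in> Basis H \<Longrightarrow> c \<in> Basis H \<Longrightarrow>
      counit H (bmult H b c) = bcounit H b * bcounit H c"
  shows "is_bialgebra H"
  unfolding is_bialgebra_def
proof (intro ballI conjI assms(1-4))
  fix u v assume uv: "u \<in> vecs H" "v \<in> vecs H"
  have "comult H (amult H u v) = lin (\<lambda>b. lin (\<lambda>c. comult H (bmult H b c)) v) u"
    by (simp add: comult_def amult_def lin_lin)
  also have "\<dots> = lin (\<lambda>b. lin (\<lambda>c. amult (tensor_alg H H) (bcomult H b) (bcomult H c)) v) u"
    using uv assms(5) by (intro lin_cong_vecs[where A = H]) auto
  finally show "comult H (amult H u v) = amult (tensor_alg H H) (comult H u) (comult H v)"
    by (simp add: comult_def amult_lin_lin)
  have "counit H (amult H u v) = (\<Sum>b\<in>Poly_Mapping.keys u. Poly_Mapping.lookup u b *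
      (\<Sum>c\<in>Poly_Mapping.keys v. Poly_Mapping.lookup v c * counit H (bmult H b c)))"
    by (simp add: amult_def counit_lin_comp)
  also have "\<dots> = (\<Sum>b\<in>Poly_Mapping.keys u. Poly_Mapping.lookup u b *
      (\<Sum>c\<in>Poly_Mapping.keys v. Poly_Mapping.lookup v c * (bcounit H b * bcounit H c)))"
    using uv assms(6) by (intro sum.cong refl arg_cong[of _ _ "\<lambda>t. _ * t"]) (auto simp: vecs_def)
  also have "\<dots> = counit H u * counit H v"
    unfolding counit_def sum_product
    by (intro sum.cong refl) (simp only: sum_distrib_left ac_simps)
  finally show "counit H (amult H u v) = counit H u * counit H v" .
qed

lemma A_C2_is_hopf_algebra: "is_hopf_algebra (A_C2 n :: (_, 'k::field) hopf_data)"
proof -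
  let ?A = "A_C2 n :: (_, 'k) hopf_data"
  note [simp] = A_C2_Basis A_C2_unit A_C2_bmult A_C2_bcomult A_C2_bcounit A_C2_bantipode
    vecs_bvec vecs_0 vecs_uminus C2_power_closed tensor_alg_simps tens_lin amult_lin lin_add lin_smul
    lin_uminus counit_simps C2_power_self
  have "is_coalgebra ?A"
    by (rule is_coalgebra_basisI)
      (auto simp: comult_tens_id_def id_tens_comult_def tmap_def reassoc_def intro!: vecs_add)
  moreover have "comult ?A (bmult ?A b c) = amult (tensor_alg ?A ?A) (bcomult ?A b) (bcomult ?A c)"
    "counit ?A (bmult ?A b c) = bcounit ?A b * bcounit ?A c"
    if bc: "b \<in> Basis ?A" "c \<in> Basis ?A" for b c
  proof -
    obtain i j e p i' j' e' p' where *: "b = ((i, j, e), p)" "c = ((i', j', e'), p')" by (cases b; cases c) auto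
    have ij: "i \<in> {0, 1}" "j \<in> {0, 1}" "e \<in> {0, 1}" "i' \<in> {0, 1}" "j' \<in> {0, 1}" "e' \<in> {0, 1}"
      using bc unfolding * by (auto simp del: insert_iff)
    show "comult ?A (bmult ?A b c) = amult (tensor_alg ?A ?A) (bcomult ?A b) (bcomult ?A c)"
      "counit ?A (bmult ?A b c) = bcounit ?A b * bcounit ?A c"
      unfolding * using ij by (elim insertE emptyE; simp add: comult_def)+
  qed
  ultimately have "is_bialgebra ?A"
    by (intro is_bialgebra_basisI A_C2_is_algebra) (simp_all add: comult_def)
  moreover have "lin (bantipode ?A) v \<in> vecs ?A \<and>
        lin (\<lambda>(b, c). amult ?A (bantipode ?A b) (bvec c)) (comult ?A v) = counit ?A v \<odot> unit_el ?A \<and>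
        lin (\<lambda>(b, c). amult ?A (bvec b) (bantipode ?A c)) (comult ?A v) = counit ?A v \<odot> unit_el ?A"
    if v: "v \<in> vecs ?A" for v
    unfolding counit_smul_lin comult_def lin_lin
    by (intro conjI vecs_lin[OF v] lin_cong_vecs[OF v]; auto)
  ultimately show ?thesis by (auto simp: is_hopf_algebra_def)
qed

end

theory Submission
  imports Defs
begin

text \<open>
  Let \<open>Y = x \<otimes> gx\<close>, so that \<open>\<alpha> x \<otimes> xg = - \<alpha> Y\<close> and \<open>R\<^sub>a = R\<^sub>q (1 \<otimes> 1 + a Y)\<close>.  The bicharacter part \<open>R\<^sub>q\<close>
  equals both \<open>\<Sum> e \<otimes> \<phi>\<close> and \<open>\<Sum> u \<otimes> e'\<close> with \<open>u, \<phi>\<close> group-like and \<open>e, e'\<close> running over orthogonal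
  idempotents; this gives that \<open>R\<^sub>q\<close> is quasitriangular and that
  \<open>(R\<^sub>q)\<^sub>1\<^sub>2\<^sup>-\<^sup>1 Y\<^sub>1\<^sub>3 (R\<^sub>q)\<^sub>1\<^sub>2 = (R\<^sub>q)\<^sub>2\<^sub>3\<^sup>-\<^sup>1 Y\<^sub>1\<^sub>3 (R\<^sub>q)\<^sub>2\<^sub>3 = x \<otimes> g \<otimes> gx\<close>.  Hence \<open>Y\<close> is an infinitesimal R-matrix for \<open>R\<^sub>q\<close>.
  Since \<open>x\<^sup>2 = 0\<close>, the element \<open>Y\<close> and these conjugates annihilate each other, so deforming \<open>R\<^sub>q\<close> by
  the unipotent factor \<open>1 \<otimes> 1 + a Y\<close> preserves quasitriangularity and leaves the conjugates unchanged.
\<close>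

abbreviation amult_in ("(_/ \<cdot>\<^bsub>_\<^esub> _)" [70, 0, 71] 70) where
  "u \<cdot>\<^bsub>A\<^esub> v \<equiv> amult A u v"

section \<open>Tensor products of algebras\<close>

lemma tens_sum: "sum f S \<otimes> v = (\<Sum>s\<in>S. f s \<otimes> v)" "v \<otimes> sum f S = (\<Sum>s\<in>S. v \<otimes> f s)"
  by (induction S rule: infinite_finite_induct) (auto simp: tens_lin)

lemma amult_sum: "amult A (sum f S) v = (\<Sum>s\<in>S. amult A (f s) v)"
    "amult A v (sum f S) = (\<Sum>s\<in>S. amult A v (f s))"
  by (induction S rule: infinite_finite_induct) (auto simp: amult_lin)

lemma vecs_diff: "u \<in> vecs A \<Longrightarrow> v \<in> vecs A \<Longrightarrow> u - v \<in> vecs A"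
  using vecs_add[of u A "- v"] by (simp add: vecs_uminus)

lemma amult_diff: "(u - v) \<cdot>\<^bsub>A\<^esub> w = u \<cdot>\<^bsub>A\<^esub> w - v \<cdot>\<^bsub>A\<^esub> w" "w \<cdot>\<^bsub>A\<^esub> (u - v) = w \<cdot>\<^bsub>A\<^esub> u - w \<cdot>\<^bsub>A\<^esub> v"
  using amult_lin(1)[of A u "- v" w] amult_lin(2)[of A w u "- v"] by (simp_all add: amult_lin)

lemma lin_tens: "lin f (u \<otimes> v) = lin (\<lambda>b. lin (\<lambda>c. f (b, c)) v) u"
  by (simp add: tens_def lin_lin)

lemma tens_lin_lin: "lin f u \<otimes> lin g v = lin (\<lambda>b. lin (\<lambda>c. f b \<otimes> g c) v) u"
proof -
  have "lin f u \<otimes> lin g v = lin (\<lambda>b. f b \<otimes> lin g v) u"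
    by (simp add: tens_def lin_lin)
  also have "\<dots> = lin (\<lambda>b. lin (\<lambda>c. f b \<otimes> g c) v) u"
    by (rule lin_cong) (subst tens_def, subst lin_swap, simp add: lin_lin tens_def)
  finally show ?thesis .
qed

lemma tens_vecs: "u \<in> vecs A \<Longrightarrow> v \<in> vecs B \<Longrightarrow> u \<otimes> v \<in> vecs (tensor_alg A B)"
  unfolding tens_def by (intro vecs_lin[of u A] vecs_lin[of v B]) (auto simp: vecs_bvec tensor_alg_simps)

lemma amult_tens: "u \<otimes> v \<cdot>\<^bsub>tensor_alg A B\<^esub> u' \<otimes> v' = (u \<cdot>\<^bsub>A\<^esub> u') \<otimes> (v \<cdot>\<^bsub>B\<^esub> v')"
proof -
  have "u \<otimes> v \<cdot>\<^bsub>tensor_alg A B\<^esub> u' \<otimes> v' =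
      lin (\<lambda>b. lin (\<lambda>c. lin (\<lambda>b'. lin (\<lambda>c'. bmult A b b' \<otimes> bmult B c c') v') u') v) u"
    by (simp add: amult_def lin_tens tensor_alg_simps)
  also have "\<dots> = (u \<cdot>\<^bsub>A\<^esub> u') \<otimes> (v \<cdot>\<^bsub>B\<^esub> v')"
    by (simp add: amult_def tens_lin_lin)
  finally show ?thesis .
qed

lemma is_algebraD:
  assumes "is_algebra A"
  shows "unit_el A \<in> vecs A"
    "u \<in> vecs A \<Longrightarrow> v \<in> vecs A \<Longrightarrow> u \<cdot>\<^bsub>A\<^esub> v \<in> vecs A"
    "u \<in> vecs A \<Longrightarrow> v \<in> vecs A \<Longrightarrow> w \<in> vecs A \<Longrightarrow> u \<cdot>\<^bsub>A\<^esub> v \<cdot>\<^bsub>A\<^esub> w = u \<cdot>\<^bsub>A\<^esub> (v \<cdot>\<^bsub>A\<^esub> w)"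
    "v \<in> vecs A \<Longrightarrow> unit_el A \<cdot>\<^bsub>A\<^esub> v = v" "v \<in> vecs A \<Longrightarrow> v \<cdot>\<^bsub>A\<^esub> unit_el A = v"
  using assms by (auto simp: is_algebra_def)

text \<open>Basis vectors of the product are pure tensors and these multiply legwise, so the axioms,
  tested on basis vectors only, are inherited from the factors.\<close>

lemma is_algebra_tensor_alg:
  fixes A :: "('b, 'k::field, 'y) alg_data_scheme" and B :: "('c, 'k, 'z) alg_data_scheme"
  assumes "is_algebra A" "is_algebra B"
  shows "is_algebra (tensor_alg A B)"
proof -
  note A = is_algebraD[OF assms(1)] and B = is_algebraD[OF assms(2)]
  have pair: "bvec (b, c) = bvec b \<otimes> (bvec c :: _ \<Rightarrow>\<^sub>0 'k)" for b :: 'b and c :: 'c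
    by (simp add: tens_lin)
  have bm: "bmult A b b' = bvec b \<cdot>\<^bsub>A\<^esub> bvec b'" "bmult B c c' = bvec c \<cdot>\<^bsub>B\<^esub> bvec c'" for b b' c c'
    by (simp_all add: amult_lin)
  show ?thesis
    by (rule is_algebra_basisI)
      (auto simp: tensor_alg_simps pair amult_tens bm A B vecs_bvec intro!: tens_vecs)
qed

text \<open>Associativity makes a two-sided inverse unique, so the description defining
  \<open>ainv\<close> is evaluated by exhibiting one.\<close>

lemma ainv_eqI:
  assumes "is_algebra A" "u \<in> vecs A" "v \<in> vecs A" "u \<cdot>\<^bsub>A\<^esub> v = unit_el A" "v \<cdot>\<^bsub>A\<^esub> u = unit_el A"
  shows "ainv A u = v"
  unfolding ainv_def
proof (rule the_equality)
  fix w assume w: "w \<in> vecs A \<and> u \<cdot>\<^bsub>A\<^esub> w = unit_el A \<and> w \<cdot>\<^bsub>A\<^esub> u = unit_el A"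
  then have "w = v \<cdot>\<^bsub>A\<^esub> u \<cdot>\<^bsub>A\<^esub> w" using w by (simp only: assms(5) is_algebraD(4)[OF assms(1)])
  also have "\<dots> = v \<cdot>\<^bsub>A\<^esub> (u \<cdot>\<^bsub>A\<^esub> w)" using assms w by (intro is_algebraD(3)) auto
  also have "\<dots> = v" using assms w by (simp add: is_algebraD)
  finally show "w = v" .
qed (use assms in simp)

section \<open>Flip, rebracketing and the leg embeddings\<close>

lemma flip_simps:
  "flip (u \<otimes> v) = v \<otimes> u" "flip (S + T) = flip S + flip T" "flip (c \<odot> T) = c \<odot> flip T"
  "flip (- T) = - flip T" "flip 0 = 0" "flip (bvec (x, y)) = bvec (y, x)"
proof -
  show "flip (u \<otimes> v) = v \<otimes> u" by (simp add: flip_def lin_tens) (simp add: lin_swap[of _ v] tens_def)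
qed (simp_all add: flip_def lin_add lin_smul lin_uminus)

lemma reassoc_simps:
  "reassoc ((u \<otimes> v) \<otimes> w) = u \<otimes> v \<otimes> w" "reassoc (S + T) = reassoc S + reassoc T"
  "reassoc (c \<odot> T) = c \<odot> reassoc T" "reassoc (- T) = - reassoc T" "reassoc 0 = 0"
  by (simp_all add: reassoc_def lin_tens lin_add lin_smul lin_uminus)
    (simp add: tens_def lin_lin)

lemma leg_simps:
  "leg12 H (u \<otimes> v) = u \<otimes> v \<otimes> unit_el H" "leg23 H (u \<otimes> v) = unit_el H \<otimes> u \<otimes> v"
  "leg13 H (u \<otimes> v) = u \<otimes> unit_el H \<otimes> v"
  "leg12 H (S + T) = leg12 H S + leg12 H T" "leg23 H (S + T) = leg23 H S + leg23 H T"
  "leg13 H (S + T) = leg13 H S + leg13 H T"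
  "leg12 H (c \<odot> T) = c \<odot> leg12 H T" "leg23 H (c \<odot> T) = c \<odot> leg23 H T"
  "leg13 H (c \<odot> T) = c \<odot> leg13 H T"
  "leg12 H (- T) = - leg12 H T" "leg23 H (- T) = - leg23 H T"
  "leg13 H (- T) = - leg13 H T"
  "leg12 H (sum f I) = (\<Sum>i\<in>I. leg12 H (f i))" "leg23 H (sum f I) = (\<Sum>i\<in>I. leg23 H (f i))"
  "leg13 H (sum f I) = (\<Sum>i\<in>I. leg13 H (f i))"
proof -
  show "leg13 H (u \<otimes> v) = u \<otimes> unit_el H \<otimes> v"
    \<comment> \<open>The constant factor \<open>unit_el H\<close> is presented as the image of an
      arbitrary basis vector under a constant map, so that the bilinear expansion also covers the
      inner tensor.\<close>
    using tens_lin_lin[of bvec u "\<lambda>c. unit_el H \<otimes> bvec c" v]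
      tens_lin_lin[of "\<lambda>_. unit_el H" "bvec undefined" bvec v]
    by (simp add: leg13_def lin_tens lin_bvec_id)
  show "leg12 H (sum f I) = (\<Sum>i\<in>I. leg12 H (f i))"
    by (simp add: leg12_def tens_sum reassoc_def lin_sum)
qed (simp_all add: leg12_def leg23_def leg13_def tens_lin reassoc_simps lin_add lin_smul lin_uminus tens_sum lin_sum)

text \<open>Both sides are bilinear in \<open>S\<close> and \<open>T\<close>, so pairs of basis
  vectors suffice. This is the common source of multiplicativity for rebracketing, legs and
  one-sided coproducts.\<close>

lemma lin_amult:
  assumes "\<And>b c. b \<in> Basis A \<Longrightarrow> c \<in> Basis A \<Longrightarrow> lin f (bmult A b c) = f b \<cdot>\<^bsub>B\<^esub> f c"
    and "S \<in> vecs A" "T \<in> vecs A"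
  shows "lin f (S \<cdot>\<^bsub>A\<^esub> T) = lin f S \<cdot>\<^bsub>B\<^esub> lin f T"
proof -
  have "lin f (S \<cdot>\<^bsub>A\<^esub> T) = lin (\<lambda>b. lin (\<lambda>c. lin f (bmult A b c)) T) S"
    by (simp add: amult_def lin_lin)
  also have "\<dots> = lin (\<lambda>b. lin (\<lambda>c. f b \<cdot>\<^bsub>B\<^esub> f c) T) S"
    using assms by (intro lin_cong_vecs[where A = A]) auto
  finally show ?thesis by (simp add: amult_lin_lin)
qed

lemma reassoc_amult:
  assumes "S \<in> vecs (tensor_alg (tensor_alg A B) C)" "T \<in> vecs (tensor_alg (tensor_alg A B) C)"
  shows "reassoc (S \<cdot>\<^bsub>tensor_alg (tensor_alg A B) C\<^esub> T) =
    reassoc S \<cdot>\<^bsub>tensor_alg A (tensor_alg B C)\<^esub> reassoc T"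
  unfolding reassoc_def
  by (rule lin_amult[OF _ assms])
    (auto simp: reassoc_def[symmetric] reassoc_simps tensor_alg_simps amult_lin)

text \<open>Brings these two legs into the shape \<open>lin f\<close> to which
  \<open>lin_amult\<close> applies; \<open>leg13\<close> has that shape by definition.\<close>

lemma leg_lin:
  "leg12 H T = lin (\<lambda>(b, c). bvec b \<otimes> bvec c \<otimes> unit_el H) T"
  "leg23 H T = lin (\<lambda>(b, c). unit_el H \<otimes> bvec b \<otimes> bvec c) T"
proof -
  show "leg12 H T = lin (\<lambda>(b, c). bvec b \<otimes> bvec c \<otimes> unit_el H) T"
    unfolding leg12_def reassoc_def lin_tens
    by (rule lin_cong) (auto simp: tens_def lin_lin)
  show "leg23 H T = lin (\<lambda>(b, c). unit_el H \<otimes> bvec b \<otimes> bvec c) T"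
    unfolding leg23_def
    by (subst (1) lin_bvec_id[of T, symmetric])
      (simp add: tens_lin case_prod_unfold, simp add: tens_def, subst lin_swap, simp add: lin_lin)
qed

lemma leg_amult:
  assumes "is_algebra H" "S \<in> vecs (tensor2 H)" "T \<in> vecs (tensor2 H)"
  shows "leg12 H (S \<cdot>\<^bsub>tensor2 H\<^esub> T) = leg12 H S \<cdot>\<^bsub>tensor3 H\<^esub> leg12 H T"
    "leg23 H (S \<cdot>\<^bsub>tensor2 H\<^esub> T) = leg23 H S \<cdot>\<^bsub>tensor3 H\<^esub> leg23 H T"
    "leg13 H (S \<cdot>\<^bsub>tensor2 H\<^esub> T) = leg13 H S \<cdot>\<^bsub>tensor3 H\<^esub> leg13 H T"
proof -
  note [simp] = is_algebraD[OF assms(1)] tensor2_def tensor3_def amult_tens tensor_alg_simps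
  show "leg12 H (S \<cdot>\<^bsub>tensor2 H\<^esub> T) = leg12 H S \<cdot>\<^bsub>tensor3 H\<^esub> leg12 H T"
    unfolding leg_lin
    by (rule lin_amult[OF _ assms(2,3)])
      (auto simp: leg_lin[symmetric] leg_simps amult_lin(9))
  show "leg23 H (S \<cdot>\<^bsub>tensor2 H\<^esub> T) = leg23 H S \<cdot>\<^bsub>tensor3 H\<^esub> leg23 H T"
    unfolding leg_lin
    by (rule lin_amult[OF _ assms(2,3)])
      (auto simp: leg_lin[symmetric] leg_simps amult_lin(9))
  show "leg13 H (S \<cdot>\<^bsub>tensor2 H\<^esub> T) = leg13 H S \<cdot>\<^bsub>tensor3 H\<^esub> leg13 H T"
    unfolding leg13_def
    by (rule lin_amult[OF _ assms(2,3)])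
      (auto simp: leg13_def[symmetric] leg_simps amult_lin(9))
qed

lemma leg_vecs:
  assumes "is_algebra H" "T \<in> vecs (tensor2 H)"
  shows "leg12 H T \<in> vecs (tensor3 H)" "leg23 H T \<in> vecs (tensor3 H)" "leg13 H T \<in> vecs (tensor3 H)"
proof -
  note is_algebraD(1)[OF assms(1), simp]
  show "leg12 H T \<in> vecs (tensor3 H)" "leg23 H T \<in> vecs (tensor3 H)" "leg13 H T \<in> vecs (tensor3 H)"
    unfolding leg_lin leg13_def tensor3_def
    by (rule vecs_lin[OF assms(2)];
        force simp: tensor2_def tensor_alg_simps vecs_bvec intro!: tens_vecs)+
qed

section \<open>The coproduct on one tensor factor\<close>

lemma comult_tens_simps:
  "id_tens_comult H (u \<otimes> v) = u \<otimes> comult H v"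
  "id_tens_comult H (S + T) = id_tens_comult H S + id_tens_comult H T"
  "id_tens_comult H (c \<odot> T) = c \<odot> id_tens_comult H T"
  "comult_tens_id H (u \<otimes> v) = reassoc (comult H u \<otimes> v)"
  "comult_tens_id H (S + T) = comult_tens_id H S + comult_tens_id H T"
  "comult_tens_id H (c \<odot> T) = c \<odot> comult_tens_id H T"
  by (simp_all add: id_tens_comult_def comult_tens_id_def comult_def tmap_def lin_tens lin_add lin_smul
      reassoc_simps tens_lin_lin[of bvec u, symmetric] tens_lin_lin[of _ u bvec, symmetric] lin_bvec_id)

lemma comult_vecs:
  assumes "is_bialgebra H"
  shows "v \<in> vecs H \<Longrightarrow> comult H v \<in> vecs (tensor_alg H H)"
    "b \<in> Basis H \<Longrightarrow> bcomult H b \<in> vecs (tensor_alg H H)"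
proof -
  show *: "comult H v \<in> vecs (tensor_alg H H)" if "v \<in> vecs H" for v
    using assms that by (auto simp: is_bialgebra_def is_coalgebra_def)
  show "b \<in> Basis H \<Longrightarrow> bcomult H b \<in> vecs (tensor_alg H H)"
    using *[of "bvec b"] by (simp add: comult_def vecs_bvec)
qed

lemma bcomult_bmult:
  assumes "is_bialgebra H" "b \<in> Basis H" "c \<in> Basis H"
  shows "comult H (bmult H b c) = bcomult H b \<cdot>\<^bsub>tensor_alg H H\<^esub> bcomult H c"
proof -
  have "comult H (bvec b \<cdot>\<^bsub>H\<^esub> bvec c) = comult H (bvec b) \<cdot>\<^bsub>tensor_alg H H\<^esub> comult H (bvec c)"
    using assms unfolding is_bialgebra_def vecs_bvec[symmetric] by blast
  then show ?thesis by (simp add: comult_def amult_lin)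
qed

text \<open>In a bialgebra the coproduct is an algebra homomorphism, hence so is its tensor product
  with the identity.\<close>

lemma comult_tens_amult:
  assumes "is_bialgebra H" "S \<in> vecs (tensor2 H)" "T \<in> vecs (tensor2 H)"
  shows "id_tens_comult H (S \<cdot>\<^bsub>tensor2 H\<^esub> T) = id_tens_comult H S \<cdot>\<^bsub>tensor3 H\<^esub> id_tens_comult H T"
    "comult_tens_id H (S \<cdot>\<^bsub>tensor2 H\<^esub> T) = comult_tens_id H S \<cdot>\<^bsub>tensor3 H\<^esub> comult_tens_id H T"
proof -
  note [simp] = tensor2_def tensor3_def amult_tens tensor_alg_simps
  show "id_tens_comult H (S \<cdot>\<^bsub>tensor2 H\<^esub> T) = id_tens_comult H S \<cdot>\<^bsub>tensor3 H\<^esub> id_tens_comult H T"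
    unfolding id_tens_comult_def tmap_def
    by (rule lin_amult[OF _ assms(2,3)])
      (auto simp: id_tens_comult_def[unfolded tmap_def, symmetric] comult_tens_simps amult_lin(9)
        bcomult_bmult[OF assms(1)])
  \<comment> \<open>The values first lie in the left-bracketed threefold product; multiplicativity
    is shown there and carried over by \<open>reassoc_amult\<close>.\<close>
  have "tmap (bcomult H) bvec (S \<cdot>\<^bsub>tensor2 H\<^esub> T) = tmap (bcomult H) bvec S
      \<cdot>\<^bsub>tensor_alg (tensor_alg H H) H\<^esub> tmap (bcomult H) bvec T"
    unfolding tmap_def
    by (rule lin_amult[OF _ assms(2,3)])
      (auto simp: lin_tens amult_lin(9) bcomult_bmult[OF assms(1), symmetric] comult_def
        tens_lin_lin[of _ _ bvec, symmetric] lin_bvec_id)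
  moreover have "tmap (bcomult H) bvec S \<in> vecs (tensor_alg (tensor_alg H H) H)"
    if "S \<in> vecs (tensor2 H)" for S
    unfolding tmap_def
    by (rule vecs_lin[OF that])
      (auto simp: vecs_bvec comult_vecs[OF assms(1)] intro!: tens_vecs)
  ultimately show "comult_tens_id H (S \<cdot>\<^bsub>tensor2 H\<^esub> T) = comult_tens_id H S \<cdot>\<^bsub>tensor3 H\<^esub> comult_tens_id H T"
    using assms(2,3) by (simp add: comult_tens_id_def reassoc_amult)
qed

section \<open>Deforming a triangular structure by a nilpotent infinitesimal R-matrix\<close>

text \<open>Since \<open>N\<close> squares to 0, \<open>P'\<close> inverts \<open>P\<close>. The
  relation \<open>conj\<close> turns \<open>V\<close> into \<open>Z\<close> when it passes
  \<open>R\<close>, and the vanishing of both mixed products of \<open>N\<close> and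
  \<open>Z\<close> removes the remaining terms. In threefold tensors, \<open>N\<close> will be the
  12 or 23 leg of \<open>Y\<close>, and \<open>V\<close> and \<open>S\<close> the 13 legs of
  \<open>Y\<close> and \<open>R\<close>.\<close>

lemma nilpotent_deformation:
  fixes T :: "('b, 'k::field, 'z) alg_data_scheme" and a c :: 'k
  assumes alg: "is_algebra T"
    and vecs: "R \<in> vecs T" "R' \<in> vecs T" "S \<in> vecs T" "N \<in> vecs T" "V \<in> vecs T" "Z \<in> vecs T"
    and inv: "R \<cdot>\<^bsub>T\<^esub> R' = unit_el T" "R' \<cdot>\<^bsub>T\<^esub> R = unit_el T"
    and conj: "R \<cdot>\<^bsub>T\<^esub> Z = V \<cdot>\<^bsub>T\<^esub> R"
    and nil: "N \<cdot>\<^bsub>T\<^esub> N = 0" "N \<cdot>\<^bsub>T\<^esub> Z = 0" "Z \<cdot>\<^bsub>T\<^esub> N = 0"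
  defines "P \<equiv> unit_el T + a \<odot> N" and "P' \<equiv> unit_el T - a \<odot> N"
  shows "R \<cdot>\<^bsub>T\<^esub> P \<cdot>\<^bsub>T\<^esub> (P' \<cdot>\<^bsub>T\<^esub> R') = unit_el T" "P' \<cdot>\<^bsub>T\<^esub> R' \<cdot>\<^bsub>T\<^esub> (R \<cdot>\<^bsub>T\<^esub> P) = unit_el T"
    "ainv T (R \<cdot>\<^bsub>T\<^esub> P) \<cdot>\<^bsub>T\<^esub> (c \<odot> V) \<cdot>\<^bsub>T\<^esub> (R \<cdot>\<^bsub>T\<^esub> P) = c \<odot> Z"
    "S \<cdot>\<^bsub>T\<^esub> (unit_el T + a \<odot> V) \<cdot>\<^bsub>T\<^esub> (R \<cdot>\<^bsub>T\<^esub> P) = S \<cdot>\<^bsub>T\<^esub> R \<cdot>\<^bsub>T\<^esub> (unit_el T + a \<odot> (N + Z))"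
proof -
  note [simp] = vecs inv nil is_algebraD[OF alg] vecs_add vecs_smul vecs_diff vecs_0 amult_lin amult_diff
  have assoc: "u \<cdot>\<^bsub>T\<^esub> (v \<cdot>\<^bsub>T\<^esub> w) = u \<cdot>\<^bsub>T\<^esub> v \<cdot>\<^bsub>T\<^esub> w" if "u \<in> vecs T" "v \<in> vecs T" "w \<in> vecs T" for u v w
    using that by simp
  \<comment> \<open>Words are bracketed to the right, so each relation is restated with a tail
    \<open>w\<close>; the last one moves \<open>R\<close> to the left past \<open>V\<close>.\<close>
  have [simp]: "R \<cdot>\<^bsub>T\<^esub> (R' \<cdot>\<^bsub>T\<^esub> w) = w" "R' \<cdot>\<^bsub>T\<^esub> (R \<cdot>\<^bsub>T\<^esub> w) = w" "N \<cdot>\<^bsub>T\<^esub> (N \<cdot>\<^bsub>T\<^esub> w) = 0"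
    "N \<cdot>\<^bsub>T\<^esub> (Z \<cdot>\<^bsub>T\<^esub> w) = 0" "Z \<cdot>\<^bsub>T\<^esub> (N \<cdot>\<^bsub>T\<^esub> w) = 0" "V \<cdot>\<^bsub>T\<^esub> (R \<cdot>\<^bsub>T\<^esub> w) = R \<cdot>\<^bsub>T\<^esub> (Z \<cdot>\<^bsub>T\<^esub> w)"
    if "w \<in> vecs T" for w
    using that by (simp_all only: assoc vecs inv nil conj[symmetric] is_algebraD(2,4)[OF alg] amult_lin)
  have [simp]: "P \<in> vecs T" "P' \<in> vecs T" by (simp_all add: P_def P'_def)
  show 1: "R \<cdot>\<^bsub>T\<^esub> P \<cdot>\<^bsub>T\<^esub> (P' \<cdot>\<^bsub>T\<^esub> R') = unit_el T" "P' \<cdot>\<^bsub>T\<^esub> R' \<cdot>\<^bsub>T\<^esub> (R \<cdot>\<^bsub>T\<^esub> P) = unit_el T"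
    by (simp_all add: P_def P'_def)
  have "ainv T (R \<cdot>\<^bsub>T\<^esub> P) = P' \<cdot>\<^bsub>T\<^esub> R'" by (rule ainv_eqI) (use 1 alg in auto)
  then show "ainv T (R \<cdot>\<^bsub>T\<^esub> P) \<cdot>\<^bsub>T\<^esub> (c \<odot> V) \<cdot>\<^bsub>T\<^esub> (R \<cdot>\<^bsub>T\<^esub> P) = c \<odot> Z"
    by (simp add: P_def P'_def conj[symmetric])
  show "S \<cdot>\<^bsub>T\<^esub> (unit_el T + a \<odot> V) \<cdot>\<^bsub>T\<^esub> (R \<cdot>\<^bsub>T\<^esub> P) = S \<cdot>\<^bsub>T\<^esub> R \<cdot>\<^bsub>T\<^esub> (unit_el T + a \<odot> (N + Z))"
    by (simp add: P_def conj[symmetric] smul_add ac_simps)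
qed

text \<open>
  The hypotheses on \<open>Z\<close> and \<open>W\<close> say that \<open>Y\<close> is an infinitesimal \<open>R\<close>-matrix, where
  \<open>Z = R\<^sub>1\<^sub>2\<inverse> Y\<^sub>1\<^sub>3 R\<^sub>1\<^sub>2\<close> and \<open>W = R\<^sub>2\<^sub>3\<inverse> Y\<^sub>1\<^sub>3 R\<^sub>2\<^sub>3\<close> are given in closed form.
\<close>

lemma infinitesimal_R_matrix_deformation:
  fixes H :: "('b, 'k::field) hopf_data" and a \<alpha> :: 'k
  assumes qt: "quasitriangular_bialgebra H R"
    and Y: "Y \<in> vecs (tensor2 H)" "Y \<cdot>\<^bsub>tensor2 H\<^esub> Y = 0"
    and central: "\<And>v. v \<in> vecs H \<Longrightarrow> Y \<cdot>\<^bsub>tensor2 H\<^esub> comult H v = comult H v \<cdot>\<^bsub>tensor2 H\<^esub> Y"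
    and Z: "Z \<in> vecs (tensor3 H)" "id_tens_comult H Y = leg12 H Y + Z"
      "leg12 H R \<cdot>\<^bsub>tensor3 H\<^esub> Z = leg13 H Y \<cdot>\<^bsub>tensor3 H\<^esub> leg12 H R"
      "leg12 H Y \<cdot>\<^bsub>tensor3 H\<^esub> Z = 0" "Z \<cdot>\<^bsub>tensor3 H\<^esub> leg12 H Y = 0"
    and W: "W \<in> vecs (tensor3 H)" "comult_tens_id H Y = leg23 H Y + W"
      "leg23 H R \<cdot>\<^bsub>tensor3 H\<^esub> W = leg13 H Y \<cdot>\<^bsub>tensor3 H\<^esub> leg23 H R"
      "leg23 H Y \<cdot>\<^bsub>tensor3 H\<^esub> W = 0" "W \<cdot>\<^bsub>tensor3 H\<^esub> leg23 H Y = 0"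
  shows "infinitesimal_R_matrix H
    (R \<cdot>\<^bsub>tensor2 H\<^esub> (unit_el H \<otimes> unit_el H + a \<odot> Y)) (\<alpha> \<odot> Y)"
proof -
  let ?T2 = "tensor2 H" and ?T3 = "tensor3 H"
  let ?P = "unit_el ?T2 + a \<odot> Y"
  have bialg: "is_bialgebra H" using qt by (simp add: quasitriangular_bialgebra_def)
  then have alg: "is_algebra H" by (simp add: is_bialgebra_def)
  then have alg2: "is_algebra ?T2" and alg3: "is_algebra ?T3"
    by (simp_all add: tensor2_def tensor3_def is_algebra_tensor_alg)
  have unit2: "unit_el H \<otimes> unit_el H = unit_el ?T2"
    and unit3: "leg12 H (unit_el ?T2) = unit_el ?T3" "leg13 H (unit_el ?T2) = unit_el ?T3"
      "leg23 H (unit_el ?T2) = unit_el ?T3"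
    by (simp_all add: tensor2_def tensor3_def tensor_alg_simps leg_simps)
  have comult_unit: "comult H (unit_el H) = unit_el H \<otimes> unit_el H"
    using bialg by (simp add: is_bialgebra_def)
  have unit3': "id_tens_comult H (unit_el ?T2) = unit_el ?T3" "comult_tens_id H (unit_el ?T2) = unit_el ?T3"
    by (simp_all add: tensor2_def tensor3_def tensor_alg_simps comult_tens_simps comult_unit reassoc_simps)
  obtain R' where R: "R \<in> vecs ?T2" "R' \<in> vecs ?T2" "R \<cdot>\<^bsub>?T2\<^esub> R' = unit_el ?T2" "R' \<cdot>\<^bsub>?T2\<^esub> R = unit_el ?T2"
    using qt by (auto simp: quasitriangular_bialgebra_def ainvertible_def)
  have cv: "comult H v \<in> vecs ?T2" "flip (comult H v) \<in> vecs ?T2" if "v \<in> vecs H" for v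
  proof -
    show *: "comult H v \<in> vecs ?T2" using comult_vecs(1)[OF bialg that] by (simp add: tensor2_def)
    show "flip (comult H v) \<in> vecs ?T2"
      unfolding flip_def by (rule vecs_lin[OF *]) (auto simp: tensor2_def tensor_alg_simps vecs_bvec)
  qed
  have P: "?P \<in> vecs ?T2" "unit_el ?T2 - a \<odot> Y \<in> vecs ?T2"
    using is_algebraD(1)[OF alg2] Y by (auto intro!: vecs_add vecs_diff vecs_smul)
  have leg: "leg12 H (R \<cdot>\<^bsub>?T2\<^esub> ?P) = leg12 H R \<cdot>\<^bsub>?T3\<^esub> (unit_el ?T3 + a \<odot> leg12 H Y)"
    "leg23 H (R \<cdot>\<^bsub>?T2\<^esub> ?P) = leg23 H R \<cdot>\<^bsub>?T3\<^esub> (unit_el ?T3 + a \<odot> leg23 H Y)"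
    "leg13 H (R \<cdot>\<^bsub>?T2\<^esub> ?P) = leg13 H R \<cdot>\<^bsub>?T3\<^esub> (unit_el ?T3 + a \<odot> leg13 H Y)"
    using R(1) P by (simp_all add: leg_amult[OF alg] unit3 leg_simps)
  note V = leg_vecs[OF alg R(1)] leg_vecs[OF alg R(2)] leg_vecs[OF alg Y(1)]
  have inv: "leg12 H R \<cdot>\<^bsub>?T3\<^esub> leg12 H R' = unit_el ?T3" "leg12 H R' \<cdot>\<^bsub>?T3\<^esub> leg12 H R = unit_el ?T3"
    "leg23 H R \<cdot>\<^bsub>?T3\<^esub> leg23 H R' = unit_el ?T3" "leg23 H R' \<cdot>\<^bsub>?T3\<^esub> leg23 H R = unit_el ?T3"
    using R by (simp_all add: leg_amult[OF alg, symmetric] unit3)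
  have "leg12 H 0 = 0" "leg23 H 0 = 0" for H :: "('b, 'k) hopf_data"
    using leg_simps(7,8)[of H 0] by simp_all
  then have nil: "leg12 H Y \<cdot>\<^bsub>?T3\<^esub> leg12 H Y = 0" "leg23 H Y \<cdot>\<^bsub>?T3\<^esub> leg23 H Y = 0"
    using Y by (simp_all add: leg_amult[OF alg, symmetric])
  \<comment> \<open>Only invertibility is wanted here, so \<open>V\<close> and \<open>Z\<close> are
    set to 0 and \<open>S\<close> to \<open>R\<close>.\<close>
  have N2: "R \<cdot>\<^bsub>?T2\<^esub> ?P \<cdot>\<^bsub>?T2\<^esub> ((unit_el ?T2 - a \<odot> Y) \<cdot>\<^bsub>?T2\<^esub> R') = unit_el ?T2"
    "(unit_el ?T2 - a \<odot> Y) \<cdot>\<^bsub>?T2\<^esub> R' \<cdot>\<^bsub>?T2\<^esub> (R \<cdot>\<^bsub>?T2\<^esub> ?P) = unit_el ?T2"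
    by (rule nilpotent_deformation[OF alg2 R(1,2) R(1) Y(1) vecs_0 vecs_0 R(3,4) _ Y(2)]; simp add: amult_lin)+
  \<comment> \<open>The third conclusion computes the conjugate of the 13 leg of
    \<open>\<alpha> \<odot> Y\<close> by the deformed matrix; the fourth collects the product of the
    deformed legs into the undeformed product times \<open>1 + a(N + Z)\<close>, which is what the
    one-sided coproduct yields.\<close>
  note N12 = nilpotent_deformation[OF alg3 V(1,4,3,7,9) Z(1) inv(1,2) Z(3) nil(1) Z(4,5), of a]
  note N23 = nilpotent_deformation[OF alg3 V(2,5,3,8,9) W(1) inv(3,4) W(3) nil(2) W(4,5), of a]
  have "ainvertible ?T2 (R \<cdot>\<^bsub>?T2\<^esub> ?P)"
    unfolding ainvertible_def using N2(1,2) R P by (blast intro: is_algebraD(2)[OF alg2])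
  moreover have "R \<cdot>\<^bsub>?T2\<^esub> ?P \<cdot>\<^bsub>?T2\<^esub> comult H v = flip (comult H v) \<cdot>\<^bsub>?T2\<^esub> (R \<cdot>\<^bsub>?T2\<^esub> ?P)"
    if v: "v \<in> vecs H" for v
  proof -
    have "R \<cdot>\<^bsub>?T2\<^esub> ?P \<cdot>\<^bsub>?T2\<^esub> comult H v = R \<cdot>\<^bsub>?T2\<^esub> (?P \<cdot>\<^bsub>?T2\<^esub> comult H v)"
      using R P cv v by (intro is_algebraD(3)[OF alg2])
    also have "?P \<cdot>\<^bsub>?T2\<^esub> comult H v = comult H v \<cdot>\<^bsub>?T2\<^esub> ?P"
      by (simp add: amult_lin is_algebraD[OF alg2] cv v central)
    also have "R \<cdot>\<^bsub>?T2\<^esub> \<dots> = R \<cdot>\<^bsub>?T2\<^esub> comult H v \<cdot>\<^bsub>?T2\<^esub> ?P"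
      using R P cv v by (intro is_algebraD(3)[OF alg2, symmetric])
    also have "R \<cdot>\<^bsub>?T2\<^esub> comult H v = flip (comult H v) \<cdot>\<^bsub>?T2\<^esub> R"
      using qt v by (simp add: quasitriangular_bialgebra_def)
    also have "\<dots> \<cdot>\<^bsub>?T2\<^esub> ?P = flip (comult H v) \<cdot>\<^bsub>?T2\<^esub> (R \<cdot>\<^bsub>?T2\<^esub> ?P)"
      using R P cv v by (intro is_algebraD(3)[OF alg2])
    finally show ?thesis .
  qed
  moreover have "id_tens_comult H (R \<cdot>\<^bsub>?T2\<^esub> ?P) = leg13 H (R \<cdot>\<^bsub>?T2\<^esub> ?P) \<cdot>\<^bsub>?T3\<^esub> leg12 H (R \<cdot>\<^bsub>?T2\<^esub> ?P)"
    using qt unfolding leg N12(4) comult_tens_amult[OF bialg R(1) P(1)]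
    by (simp add: quasitriangular_bialgebra_def comult_tens_simps unit3' Z)
  moreover have "comult_tens_id H (R \<cdot>\<^bsub>?T2\<^esub> ?P) = leg13 H (R \<cdot>\<^bsub>?T2\<^esub> ?P) \<cdot>\<^bsub>?T3\<^esub> leg23 H (R \<cdot>\<^bsub>?T2\<^esub> ?P)"
    using qt unfolding leg N23(4) comult_tens_amult[OF bialg R(1) P(1)]
    by (simp add: quasitriangular_bialgebra_def comult_tens_simps unit3' W)
  ultimately show ?thesis
    unfolding infinitesimal_R_matrix_def quasitriangular_bialgebra_def unit2 leg leg_simps(7-9)
      N12(3) N23(3)
    using bialg Y(1) central
    by (simp add: vecs_smul amult_lin comult_tens_simps leg_simps smul_add Z W)
qed

section \<open>Characters of the Klein four-group\<close>

text \<open>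
  A homomorphism from \<open>C\<^sub>2 \<times> C\<^sub>2\<close> to the units of \<open>A\<close> is encoded as a function of two exponents,
  periodic modulo 2.
\<close>

definition klein_hom :: "('b, 'k::field, 'z) alg_data_scheme \<Rightarrow> (nat \<Rightarrow> nat \<Rightarrow> ('b \<Rightarrow>\<^sub>0 'k)) \<Rightarrow> bool" where
  "klein_hom A U \<longleftrightarrow> U 0 0 = unit_el A \<and> (\<forall>i k. U i k \<in> vecs A) \<and>
     (\<forall>i k. U (i + 2) k = U i k) \<and> (\<forall>i k. U i (k + 2) = U i k) \<and>
     (\<forall>i k i' k'. U i k \<cdot>\<^bsub>A\<^esub> U i' k' = U (i + i') (k + k'))"

text \<open>The averaging idempotent of the character
  \<open>(i, k) \<mapsto> (-1)^(i*j + k*l)\<close>; character values are signs, so no inverse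
  appears in the formula.\<close>

definition klein_idem :: "(nat \<Rightarrow> nat \<Rightarrow> ('b \<Rightarrow>\<^sub>0 'k::field)) \<Rightarrow> nat \<Rightarrow> nat \<Rightarrow> ('b \<Rightarrow>\<^sub>0 'k)" where
  "klein_idem U j l = (1 / 4) \<odot> (\<Sum>i\<in>{0..1}. \<Sum>k\<in>{0..1}. (- 1) ^ (i * j + k * l) \<odot> U i k)"

lemma sum_0_1: "sum f {0..1::nat} = f 0 + f 1"
  by simp

text \<open>A field has no zero divisors, so 4 = 0 would force 2 = 0 and thus characteristic 2. Here
  4 is the order of the group averaged over.\<close>

lemma four_nonzero: "(4 :: 'k::field) \<noteq> 0" if "CHAR('k) \<noteq> 2"
proof
  assume "(4 :: 'k) = 0"
  then have "(2 :: 'k) * 2 = 0" by simp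
  then have "(2 :: 'k) = 0" by (simp only: mult_eq_0_iff disj_absorb)
  then have "of_nat 2 = (0 :: 'k)" by simp
  then have "CHAR('k) dvd 2" by (simp only: of_nat_eq_0_iff_char_dvd)
  then have "CHAR('k) \<le> 2" "CHAR('k) \<noteq> 0" by (auto dest: dvd_imp_le intro!: Nat.gr0I)
  moreover have "CHAR('k) \<noteq> 1" by simp
  ultimately show False using that by linarith
qed

text \<open>Multiplying by a group element permutes the summands of the average; reindexing leaves
  the value of the character as a factor.\<close>

lemma klein_idem_eigen:
  assumes "klein_hom A U" "i \<in> {0, 1}" "k \<in> {0, 1}" "j \<in> {0, 1}" "l \<in> {0, 1}"
  shows "U i k \<cdot>\<^bsub>A\<^esub> klein_idem U j l = (- 1) ^ (i * j + k * l) \<odot> klein_idem U j l"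
    "klein_idem U j l \<cdot>\<^bsub>A\<^esub> U i k = (- 1) ^ (i * j + k * l) \<odot> klein_idem U j l"
proof -
  have U: "U i k \<cdot>\<^bsub>A\<^esub> U i' k' = U (i + i') (k + k')" "U (Suc (Suc i)) k = U i k" "U i (Suc (Suc k)) = U i k" for i k i' k'
    using assms(1) by (simp_all add: klein_hom_def)
  show "U i k \<cdot>\<^bsub>A\<^esub> klein_idem U j l = (- 1) ^ (i * j + k * l) \<odot> klein_idem U j l"
    "klein_idem U j l \<cdot>\<^bsub>A\<^esub> U i k = (- 1) ^ (i * j + k * l) \<odot> klein_idem U j l"
    unfolding klein_idem_def using assms(2-)
    by (elim insertE emptyE; simp add: sum_0_1 amult_lin amult_diff U;
        intro poly_mapping_eqI; simp add: lookup_add lookup_minus algebra_simps)+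
qed

text \<open>Once the left factor is expanded, each \<open>U i k\<close> acts on the right factor by
  a sign, and the coefficient becomes the normalised inner product of two characters.\<close>

lemma klein_idem_orthogonal:
  fixes U :: "nat \<Rightarrow> nat \<Rightarrow> ('b \<Rightarrow>\<^sub>0 'k::field)"
  assumes "klein_hom A U" "CHAR('k) \<noteq> 2"
    and "j \<in> {0, 1}" "l \<in> {0, 1}" "j' \<in> {0, 1}" "l' \<in> {0, 1}"
  shows "klein_idem U j l \<cdot>\<^bsub>A\<^esub> klein_idem U j' l' = (if j = j' \<and> l = l' then klein_idem U j l else 0)"
proof -
  have "klein_idem U j l \<cdot>\<^bsub>A\<^esub> klein_idem U j' l' = (1 / 4) \<odot> (\<Sum>i\<in>{0..1}. \<Sum>k\<in>{0..1}.
      (- 1) ^ (i * j + k * l) \<odot> (- 1) ^ (i * j' + k * l') \<odot> klein_idem U j' l')"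
    by (subst klein_idem_def) (simp add: sum_0_1 amult_lin klein_idem_eigen(1)[OF assms(1)] assms(3-)[simplified])
  also have "\<dots> = (1 / 4 * (\<Sum>i\<in>{0..1}. \<Sum>k\<in>{0..1}.
      (- 1) ^ (i * j + k * l) * (- 1) ^ (i * j' + k * l'))) \<odot> klein_idem U j' l'"
    by (simp only: sum_0_1 smul_add smul_simps distrib_left)
  also have "\<dots> = (if j = j' \<and> l = l' then klein_idem U j l else 0)"
    using assms(3-) four_nonzero[OF assms(2)] by (elim insertE emptyE; simp)
  finally show ?thesis .
qed

text \<open>Summing over all characters cancels every term except \<open>U 0 0\<close>, whose
  fourfold occurrence offsets the factor 1/4.\<close>

lemma klein_idem_sum:
  fixes U :: "nat \<Rightarrow> nat \<Rightarrow> ('b \<Rightarrow>\<^sub>0 'k::field)"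
  assumes "CHAR('k) \<noteq> 2"
  shows "(\<Sum>j\<in>{0..1}. \<Sum>l\<in>{0..1}. klein_idem U j l) = U 0 0"
proof (rule poly_mapping_eqI)
  fix b
  define c :: 'k where "c = 1 / 4"
  then have c: "4 * c = 1" "c = 1 / 4" using four_nonzero[OF assms] by (simp_all add: mult.commute)
  have "Poly_Mapping.lookup (\<Sum>j\<in>{0..1}. \<Sum>l\<in>{0..1}. klein_idem U j l) b = 4 * c * Poly_Mapping.lookup (U 0 0) b"
    unfolding klein_idem_def c(2)[symmetric] by (simp add: sum_0_1 lookup_add lookup_minus algebra_simps)
  then show "Poly_Mapping.lookup (\<Sum>j\<in>{0..1}. \<Sum>l\<in>{0..1}. klein_idem U j l) b = Poly_Mapping.lookup (U 0 0) b"
    by (simp only: c(1) mult_1)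
qed

lemma klein_idem_vecs: "klein_hom A U \<Longrightarrow> klein_idem U j l \<in> vecs A"
  unfolding klein_idem_def by (intro vecs_smul vecs_sum) (simp add: klein_hom_def)

text \<open>The R-matrix of the bicharacter \<open>(-1)^(i*j + k*l)\<close>. Keeping the two
  homomorphisms separate lets the parameter \<open>q\<close> enter through \<open>V\<close>
  alone.\<close>

definition klein_R :: "(nat \<Rightarrow> nat \<Rightarrow> ('b \<Rightarrow>\<^sub>0 'k::field)) \<Rightarrow> (nat \<Rightarrow> nat \<Rightarrow> ('c \<Rightarrow>\<^sub>0 'k)) \<Rightarrow> ('b \<times> 'c \<Rightarrow>\<^sub>0 'k)" where
  "klein_R U V = (1 / 4) \<odot> (\<Sum>i\<in>{0..1}. \<Sum>j\<in>{0..1}. \<Sum>k\<in>{0..1}. \<Sum>l\<in>{0..1}.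
     (- 1) ^ (i * j + k * l) \<odot> (U i k \<otimes> V j l))"

text \<open>
  Expanding one tensor factor in idempotents makes each hexagon identity, and each commutation
  with the skew-primitive generator, diagonal.
\<close>

lemma klein_R_idem:
  "klein_R U V = (\<Sum>j\<in>{0..1}. \<Sum>l\<in>{0..1}. klein_idem U j l \<otimes> V j l)"
  "klein_R U V = (\<Sum>i\<in>{0..1}. \<Sum>k\<in>{0..1}. U i k \<otimes> klein_idem V i k)"
proof -
  show "klein_R U V = (\<Sum>j\<in>{0..1}. \<Sum>l\<in>{0..1}. klein_idem U j l \<otimes> V j l)"
    by (rule poly_mapping_eqI)
      (simp add: klein_R_def klein_idem_def sum_0_1 tens_lin lookup_add lookup_minus algebra_simps)
  show "klein_R U V = (\<Sum>i\<in>{0..1}. \<Sum>k\<in>{0..1}. U i k \<otimes> klein_idem V i k)"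
    by (rule poly_mapping_eqI)
      (simp add: klein_R_def klein_idem_def sum_0_1 tens_lin lookup_add lookup_minus algebra_simps)
qed

text \<open>With the first factor in idempotents, orthogonality cuts the double sum on the right
  down to its diagonal, where the second and third legs are both \<open>V j l\<close>;
  group-likeness gives the same on the left.\<close>

lemma klein_R_id_tens_comult:
  fixes H :: "('b, 'k::field) hopf_data"
  assumes "is_algebra H" "klein_hom H U" "klein_hom H V" "CHAR('k) \<noteq> 2"
    and "\<And>j l. comult H (V j l) = V j l \<otimes> V j l"
  shows "id_tens_comult H (klein_R U V) =
    leg13 H (klein_R U V) \<cdot>\<^bsub>tensor3 H\<^esub> leg12 H (klein_R U V)"
  using assms(2,3) assms(5)[of 0 0] unfolding klein_R_idem(1)
  by (simp add: sum_0_1 comult_tens_simps leg_simps amult_lin tensor3_def amult_tens assms(5) klein_hom_def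
      klein_idem_orthogonal[OF assms(2,4)] is_algebraD[OF assms(1)] tens_lin)

text \<open>The mirror argument, with the idempotents in the second factor and group-like
  \<open>U i k\<close> in the first.\<close>

lemma klein_R_comult_tens_id:
  fixes H :: "('b, 'k::field) hopf_data"
  assumes "is_algebra H" "klein_hom H U" "klein_hom H V" "CHAR('k) \<noteq> 2"
    and "\<And>i k. comult H (U i k) = U i k \<otimes> U i k"
  shows "comult_tens_id H (klein_R U V) =
    leg13 H (klein_R U V) \<cdot>\<^bsub>tensor3 H\<^esub> leg23 H (klein_R U V)"
  using assms(2,3) assms(5)[of 0 0] unfolding klein_R_idem(2)
  by (simp add: sum_0_1 comult_tens_simps leg_simps amult_lin tensor3_def amult_tens assms(5) klein_hom_def
      klein_idem_orthogonal[OF assms(3,4)] is_algebraD[OF assms(1)] tens_lin reassoc_simps)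

text \<open>Orthogonality leaves the squares \<open>V j l\<close> times \<open>V j l\<close>, which
  are the unit, and the idempotents sum to the unit. Hence \<open>klein_R U V\<close> is its own
  inverse.\<close>

lemma klein_R_square:
  fixes U V :: "nat \<Rightarrow> nat \<Rightarrow> ('b \<Rightarrow>\<^sub>0 'k::field)"
  assumes "klein_hom H U" "klein_hom H V" "CHAR('k) \<noteq> 2"
  shows "klein_R U V \<cdot>\<^bsub>tensor_alg H H\<^esub> klein_R U V = unit_el (tensor_alg H H)"
proof -
  have V: "V j l \<cdot>\<^bsub>H\<^esub> V j l = V 0 0" if "j \<in> {0, 1}" "l \<in> {0, 1}" for j l
  proof -
    have "V (i + 2) k = V i k" "V i (k + 2) = V i k" "V i k \<cdot>\<^bsub>H\<^esub> V i' k' = V (i + i') (k + k')" for i k i' k'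
      using assms(2) by (simp_all add: klein_hom_def)
    from this(1)[of 0] this(2)[of 0] this(3) show ?thesis
      using that by (elim insertE emptyE) (simp_all add: numeral_2_eq_2)
  qed
  have "klein_R U V \<cdot>\<^bsub>tensor_alg H H\<^esub> klein_R U V = (\<Sum>j\<in>{0..1}. \<Sum>l\<in>{0..1}. klein_idem U j l) \<otimes> V 0 0"
    unfolding klein_R_idem(1)
    by (simp add: sum_0_1 amult_lin amult_tens klein_idem_orthogonal[OF assms(1,3)] tens_lin V)
  then show ?thesis
    using assms(1,2) by (simp only: klein_idem_sum[OF assms(3)] klein_hom_def tensor_alg_simps)
qed

lemma klein_R_vecs: "klein_hom A U \<Longrightarrow> klein_hom B V \<Longrightarrow> klein_R U V \<in> vecs (tensor_alg A B)"
  unfolding klein_R_def by (intro vecs_smul vecs_sum tens_vecs) (simp_all add: klein_hom_def)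

section \<open>The triangular structures on \<open>A\<^bsub>C\<^sub>2\<^sup>n\<^esub>\<close>\<close>

text \<open>The element \<open>g^i h^k\<close>, with exponents reduced modulo 2 so that all natural
  numbers are admissible and exponents simply add.\<close>

definition gh :: "nat \<Rightarrow> nat \<Rightarrow> ((nat \<times> nat \<times> nat) \<times> (nat \<Rightarrow>\<^sub>0 bit) \<Rightarrow>\<^sub>0 'k::field)" where
  "gh i k = bvec ((i mod 2, k mod 2, 0), 0)"

text \<open>The second tensor factor of \<open>R\<^sub>q\<close>.\<close>

definition gh_twist :: "nat \<Rightarrow> nat \<Rightarrow> nat \<Rightarrow> ((nat \<times> nat \<times> nat) \<times> (nat \<Rightarrow>\<^sub>0 bit) \<Rightarrow>\<^sub>0 'k::field)" where
  "gh_twist q j l = gh (j + q * (j + l)) (q * (j + l))"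

abbreviation R_C2 :: "nat \<Rightarrow> (((nat \<times> nat \<times> nat) \<times> (nat \<Rightarrow>\<^sub>0 bit)) \<times> ((nat \<times> nat \<times> nat) \<times> (nat \<Rightarrow>\<^sub>0 bit)) \<Rightarrow>\<^sub>0 'k::field)" where
  "R_C2 q \<equiv> klein_R gh (gh_twist q)"

section \<open>Group-like elements and their relations with the skew-primitive generator\<close>

lemma mod_2_in: "m mod 2 \<in> {0, 1 :: nat}"
  by auto

lemma gh_vecs: "gh i k \<in> vecs (A_C2 n)"
  using mod_2_in[of i] mod_2_in[of k] by (auto simp: gh_def vecs_bvec A_C2_Basis C2_power_closed)

lemma gh_amult: "gh i k \<cdot>\<^bsub>A_C2 n\<^esub> gh i' k' = gh (i + i') (k + k')"
  by (simp add: gh_def amult_lin A_C2_bmult mod_simps)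

lemma gh_comult: "comult (A_C2 n) (gh i k) = gh i k \<otimes> gh i k"
  by (simp only: gh_def comult_def lin_bvec A_C2_bcomult(1)[OF mod_2_in mod_2_in] tens_lin)

lemma klein_hom_gh: "klein_hom (A_C2 n) gh"
  by (simp add: klein_hom_def gh_vecs gh_amult) (simp add: gh_def A_C2_unit)

lemma gh_Suc_Suc: "gh (Suc (Suc i)) k = gh i k" "gh i (Suc (Suc k)) = gh i k"
  by (simp_all add: gh_def)

text \<open>Both exponents are additive in \<open>(j, l)\<close>, and a shift of either argument by
  2 changes them by even amounts.\<close>

lemma klein_hom_gh_twist: "q \<in> {0, 1} \<Longrightarrow> klein_hom (A_C2 n) (gh_twist q)"
  using klein_hom_gh[of n]
  by (auto simp: klein_hom_def gh_twist_def gh_vecs gh_amult gh_Suc_Suc ac_simps)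

lemma gC_hC_xC: "gC = gh 1 0" "hC = gh 0 1" "xC = bvec ((0, 0, 1), 0)"
  by (simp_all add: gC_def hC_def xC_def A22_incl_def g22_def h22_def x22_def tens_lin gh_def)

lemma apow_gh: "apow (A_C2 n) (gh i k) m = gh (m * i) (m * k)"
  by (induction m) (simp_all add: gh_amult ac_simps, simp add: gh_def A_C2_unit)

text \<open>The negative exponents are harmless because -1 is its own inverse.\<close>

lemma Rq_eq: "Rq n q = (R_C2 q :: _ \<Rightarrow>\<^sub>0 'k::field)"
proof -
  have "(- 1 :: 'k) powi (- int (i * j) - int (k * l)) = (- 1) ^ (i * j + k * l)" for i j k l
  proof -
    have "- int (i * j) - int (k * l) = - int (i * j + k * l)" by simp
    then show ?thesis
      by (simp only: power_int_minus power_int_of_nat power_inverse[symmetric] inverse_minus_eq inverse_1)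
  qed
  then show ?thesis
    by (simp only: Rq_def klein_R_def gC_hC_xC apow_gh gh_amult gh_twist_def mult_1_right mult_0_right
        add_0_left add_0_right)
qed

lemma gh_commute:
  "gh i k \<cdot>\<^bsub>A_C2 n\<^esub> bvec ((i', j', 0), p) = bvec ((i', j', 0), p) \<cdot>\<^bsub>A_C2 n\<^esub> gh i k"
  by (simp add: gh_def amult_lin A_C2_bmult mod_simps ac_simps)

lemma xC_gh: "xC \<cdot>\<^bsub>A_C2 n\<^esub> gh i k = (- 1) ^ (i + k) \<odot> (gh i k \<cdot>\<^bsub>A_C2 n\<^esub> xC)"
  by (simp add: gC_hC_xC gh_def amult_lin A_C2_bmult power_add)

lemma xC_xC: "xC \<cdot>\<^bsub>A_C2 n\<^esub> xC = 0"
  by (simp add: gC_hC_xC amult_lin A_C2_bmult)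

text \<open>In each identity the sign from moving \<open>xC\<close> past a group element in one leg
  equals the eigenvalue of \<open>gC\<close> on the idempotent in another. The first two together
  intertwine the coproduct of \<open>xC\<close> with its flip; the last two give the conjugates of
  the 13 leg.\<close>

lemma R_C2_xC:
  fixes n q :: nat
  assumes "q \<in> {0, 1}"
  defines "A \<equiv> A_C2 n :: (_, 'k::field) hopf_data"
  shows "R_C2 q \<cdot>\<^bsub>tensor_alg A A\<^esub> xC \<otimes> gC = xC \<otimes> unit_el A \<cdot>\<^bsub>tensor_alg A A\<^esub> R_C2 q"
    "R_C2 q \<cdot>\<^bsub>tensor_alg A A\<^esub> unit_el A \<otimes> xC = gC \<otimes> xC \<cdot>\<^bsub>tensor_alg A A\<^esub> R_C2 q"
    "leg12 A (R_C2 q) \<cdot>\<^bsub>tensor3 A\<^esub> xC \<otimes> gC \<otimes> (gC \<cdot>\<^bsub>A\<^esub> xC) =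
      leg13 A (xC \<otimes> (gC \<cdot>\<^bsub>A\<^esub> xC)) \<cdot>\<^bsub>tensor3 A\<^esub> leg12 A (R_C2 q)"
    "leg23 A (R_C2 q) \<cdot>\<^bsub>tensor3 A\<^esub> xC \<otimes> gC \<otimes> (gC \<cdot>\<^bsub>A\<^esub> xC) =
      leg13 A (xC \<otimes> (gC \<cdot>\<^bsub>A\<^esub> xC)) \<cdot>\<^bsub>tensor3 A\<^esub> leg23 A (R_C2 q)"
proof -
  have alg: "is_algebra A" unfolding A_def by (rule A_C2_is_algebra)
  have hom: "klein_hom A gh" "klein_hom A (gh_twist q)"
    unfolding A_def using assms by (auto intro: klein_hom_gh klein_hom_gh_twist simp del: insert_iff)
  have gx: "gC \<cdot>\<^bsub>A\<^esub> xC \<in> vecs A" "xC \<in> vecs A" "gC \<in> vecs A"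
    unfolding A_def
    by (auto simp: gC_hC_xC gh_def amult_lin A_C2_bmult vecs_bvec A_C2_Basis C2_power_closed)
  note [simp] = is_algebraD(1,4,5)[OF alg] klein_idem_vecs[OF hom(1)] klein_idem_vecs[OF hom(2)] gx
  \<comment> \<open>At \<open>j = l = 1\<close> the twisted exponents are \<open>1 + 2*q\<close> and
    \<open>2*q\<close>, so only \<open>g\<close> survives.\<close>
  have gC: "gC = gh_twist q 1 1"
    using assms by (auto simp: gC_hC_xC gh_twist_def gh_def)
  have 1: "xC \<cdot>\<^bsub>A\<^esub> gh i k = (- 1) ^ (i + k) \<odot> (gh i k \<cdot>\<^bsub>A\<^esub> xC)"
    "klein_idem (gh_twist q) i k \<cdot>\<^bsub>A\<^esub> gC = (- 1) ^ (i + k) \<odot> klein_idem (gh_twist q) i k"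
    if "i \<in> {0, 1}" "k \<in> {0, 1}" for i k
    using klein_idem_eigen(2)[OF hom(2), of 1 1 i k] that by (simp_all add: gC A_def xC_gh)
  have 2: "xC \<cdot>\<^bsub>A\<^esub> gh_twist q j l = (- 1) ^ j \<odot> (gh_twist q j l \<cdot>\<^bsub>A\<^esub> xC)"
    "gC \<cdot>\<^bsub>A\<^esub> xC \<cdot>\<^bsub>A\<^esub> gh_twist q j l = (- 1) ^ j \<odot> (gh_twist q j l \<cdot>\<^bsub>A\<^esub> (gC \<cdot>\<^bsub>A\<^esub> xC))"
    "klein_idem gh j l \<cdot>\<^bsub>A\<^esub> gC = (- 1) ^ j \<odot> klein_idem gh j l"
    "gC \<cdot>\<^bsub>A\<^esub> klein_idem gh j l = (- 1) ^ j \<odot> klein_idem gh j l"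
    if "j \<in> {0, 1}" "l \<in> {0, 1}" for j l
  proof -
    \<comment> \<open>The total exponent \<open>j + 2*q*(j + l)\<close> has the parity of
      \<open>j\<close>, so the twist does not affect the sign.\<close>
    show "xC \<cdot>\<^bsub>A\<^esub> gh_twist q j l = (- 1) ^ j \<odot> (gh_twist q j l \<cdot>\<^bsub>A\<^esub> xC)"
      by (simp add: gh_twist_def A_def xC_gh power_add mult.assoc)
    show "gC \<cdot>\<^bsub>A\<^esub> xC \<cdot>\<^bsub>A\<^esub> gh_twist q j l = (- 1) ^ j \<odot> (gh_twist q j l \<cdot>\<^bsub>A\<^esub> (gC \<cdot>\<^bsub>A\<^esub> xC))"
      by (simp add: gC_hC_xC gh_twist_def gh_def A_def amult_lin A_C2_bmult power_add mod_simps mult.assoc)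
    show "klein_idem gh j l \<cdot>\<^bsub>A\<^esub> gC = (- 1) ^ j \<odot> klein_idem gh j l"
      "gC \<cdot>\<^bsub>A\<^esub> klein_idem gh j l = (- 1) ^ j \<odot> klein_idem gh j l"
      using klein_idem_eigen[OF hom(1), of 1 0 j l] that by (simp_all add: gC_hC_xC)
  qed
  have twist [simp]: "gh_twist q j l \<in> vecs A" "gh i k \<in> vecs A" for i j k l
    using hom by (simp_all add: klein_hom_def)
  note calc = sum_0_1 amult_lin amult_diff amult_tens tens_lin tensor3_def leg_simps
  show "R_C2 q \<cdot>\<^bsub>tensor_alg A A\<^esub> xC \<otimes> gC = xC \<otimes> unit_el A \<cdot>\<^bsub>tensor_alg A A\<^esub> R_C2 q"
    unfolding klein_R_idem(2) by (simp add: calc 1)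
  show "R_C2 q \<cdot>\<^bsub>tensor_alg A A\<^esub> unit_el A \<otimes> xC = gC \<otimes> xC \<cdot>\<^bsub>tensor_alg A A\<^esub> R_C2 q"
    unfolding klein_R_idem(1) by (simp add: calc 2)
  show "leg12 A (R_C2 q) \<cdot>\<^bsub>tensor3 A\<^esub> xC \<otimes> gC \<otimes> (gC \<cdot>\<^bsub>A\<^esub> xC) =
      leg13 A (xC \<otimes> (gC \<cdot>\<^bsub>A\<^esub> xC)) \<cdot>\<^bsub>tensor3 A\<^esub> leg12 A (R_C2 q)"
    unfolding klein_R_idem(2) by (simp add: calc 1)
  show "leg23 A (R_C2 q) \<cdot>\<^bsub>tensor3 A\<^esub> xC \<otimes> gC \<otimes> (gC \<cdot>\<^bsub>A\<^esub> xC) =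
      leg13 A (xC \<otimes> (gC \<cdot>\<^bsub>A\<^esub> xC)) \<cdot>\<^bsub>tensor3 A\<^esub> leg23 A (R_C2 q)"
    unfolding klein_R_idem(1) by (simp add: calc 2)
qed

text \<open>Invertibility and both hexagons come from the bicharacter form. Intertwining is checked
  on basis vectors, each a group-like element times a power of \<open>xC\<close>.\<close>

lemma quasitriangular_R_C2:
  assumes "CHAR('k::field) \<noteq> 2" and q: "q \<in> {0, 1}"
  shows "quasitriangular_bialgebra (A_C2 n :: (_, 'k) hopf_data) (R_C2 q)"
proof -
  let ?A = "A_C2 n :: (_, 'k) hopf_data" and ?R = "R_C2 q"
  let ?T = "tensor_alg ?A ?A"
  have bialg: "is_bialgebra ?A"
    using A_C2_is_hopf_algebra[of n, where 'k = 'k] by (simp add: is_hopf_algebra_def)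
  have alg: "is_algebra ?A" "is_algebra ?T"
    by (simp_all add: A_C2_is_algebra is_algebra_tensor_alg)
  note hom = klein_hom_gh[of n, where 'a = 'k] klein_hom_gh_twist[OF q, of n, where 'a = 'k]
  have R: "?R \<in> vecs ?T" using hom by (rule klein_R_vecs)
  have x: "xC \<in> vecs ?A" "gC \<in> vecs ?A"
    by (auto simp: gC_hC_xC gh_vecs vecs_bvec A_C2_Basis C2_power_closed)
  have grouplike: "?R \<cdot>\<^bsub>?T\<^esub> bvec b \<otimes> bvec b = bvec b \<otimes> bvec b \<cdot>\<^bsub>?T\<^esub> ?R"
    if "b = ((i, j, 0), p)" for b i j p
    by (simp add: that klein_R_def sum_0_1 amult_lin amult_diff amult_tens gh_commute gh_twist_def)
  have comm: "?R \<cdot>\<^bsub>?T\<^esub> bcomult ?A b = flip (bcomult ?A b) \<cdot>\<^bsub>?T\<^esub> ?R" if b: "b \<in> Basis ?A" for b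
  proof -
    obtain i j e p where ijep: "b = ((i, j, e), p)" by (cases b) auto
    have *: "i \<in> {0, 1}" "j \<in> {0, 1}" "e = 0 \<or> e = 1" "p \<in> C2_power (n - 2)"
      using b by (auto simp: ijep A_C2_Basis)
    \<comment> \<open>The group-like factor of \<open>b\<close>: either \<open>b\<close> is
      \<open>c\<close> itself or \<open>bvec b\<close> is \<open>bvec c\<close> times
      \<open>xC\<close>.\<close>
    define c where "c = ((i, j, 0 :: nat), p)"
    have c: "bvec c \<otimes> bvec c \<in> vecs ?T" "bcomult ?A c = bvec c \<otimes> bvec c"
      using * by (auto simp: c_def vecs_bvec tensor_alg_simps A_C2_Basis A_C2_bcomult tens_lin)
    show ?thesis
    proof (cases "e = 0")
      case True
      then show ?thesis
        using grouplike[OF c_def] c(2) by (simp add: ijep c_def flip_simps)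
    next
      case False
      \<comment> \<open>The coproduct of \<open>xC\<close> and its flip;
        \<open>bvec c \<otimes> bvec c\<close> commutes with \<open>?R\<close>, so only these need
        to be intertwined.\<close>
      let ?dx = "unit_el ?A \<otimes> xC + xC \<otimes> gC" and ?dx' = "xC \<otimes> unit_el ?A + gC \<otimes> xC"
      have mem: "?dx \<in> vecs ?T" "?dx' \<in> vecs ?T"
        using x is_algebraD(1)[OF alg(1)] by (auto intro!: vecs_add tens_vecs)
      have b': "bcomult ?A b = bvec c \<otimes> bvec c \<cdot>\<^bsub>?T\<^esub> ?dx"
        "flip (bcomult ?A b) = bvec c \<otimes> bvec c \<cdot>\<^bsub>?T\<^esub> ?dx'"
        using * False by (auto simp: ijep c_def A_C2_bcomult gC_hC_xC gh_def A_C2_unit tens_lin amult_lin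
          tensor_alg_simps A_C2_bmult flip_simps)
      have "?R \<cdot>\<^bsub>?T\<^esub> bcomult ?A b = ?R \<cdot>\<^bsub>?T\<^esub> bvec c \<otimes> bvec c \<cdot>\<^bsub>?T\<^esub> ?dx"
        unfolding b'(1) using R c mem by (intro is_algebraD(3)[OF alg(2), symmetric])
      also have "\<dots> = bvec c \<otimes> bvec c \<cdot>\<^bsub>?T\<^esub> (?R \<cdot>\<^bsub>?T\<^esub> ?dx)"
        unfolding grouplike[OF c_def] using R c mem by (intro is_algebraD(3)[OF alg(2)])
      also have "?R \<cdot>\<^bsub>?T\<^esub> ?dx = ?dx' \<cdot>\<^bsub>?T\<^esub> ?R"
        by (simp add: amult_lin R_C2_xC(1,2)[OF q] add.commute)
      also have "bvec c \<otimes> bvec c \<cdot>\<^bsub>?T\<^esub> (?dx' \<cdot>\<^bsub>?T\<^esub> ?R) = flip (bcomult ?A b) \<cdot>\<^bsub>?T\<^esub> ?R"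
        unfolding b'(2) using R c mem by (intro is_algebraD(3)[OF alg(2), symmetric])
      finally show ?thesis .
    qed
  qed
  have "?R \<cdot>\<^bsub>?T\<^esub> comult ?A v = flip (comult ?A v) \<cdot>\<^bsub>?T\<^esub> ?R" if v: "v \<in> vecs ?A" for v
  proof -
    have "?R \<cdot>\<^bsub>?T\<^esub> comult ?A v = lin (\<lambda>b. ?R \<cdot>\<^bsub>?T\<^esub> bcomult ?A b) v"
      by (simp add: comult_def lin_def amult_sum amult_lin(4))
    also have "\<dots> = lin (\<lambda>b. flip (bcomult ?A b) \<cdot>\<^bsub>?T\<^esub> ?R) v"
      by (rule lin_cong_vecs[OF v comm])
    also have "\<dots> = flip (comult ?A v) \<cdot>\<^bsub>?T\<^esub> ?R"
      by (simp add: comult_def flip_def lin_lin) (simp add: lin_def amult_sum amult_lin(3))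
    finally show ?thesis .
  qed
  moreover have "comult ?A (gh_twist q j l) = gh_twist q j l \<otimes> gh_twist q j l" for j l
    by (simp add: gh_twist_def gh_comult)
  ultimately show ?thesis
    using klein_R_square[OF hom assms(1)] klein_R_id_tens_comult[OF alg(1) hom assms(1)]
      klein_R_comult_tens_id[OF alg(1) hom assms(1) gh_comult] R bialg
    by (auto simp: quasitriangular_bialgebra_def ainvertible_def tensor2_def)
qed

text \<open>The same element \<open>?Z\<close> serves as both conjugates, since
  \<open>R_C2_xC\<close> yields it for the 12 and the 23 leg alike.\<close>

lemma infinitesimal_R_matrix_R_C2:
  fixes a c :: "'k::field" and n q :: nat
  assumes "CHAR('k) \<noteq> 2" and "q \<in> {0, 1}"
  defines "A \<equiv> A_C2 n :: (_, 'k) hopf_data" and "Y \<equiv> xC \<otimes> (gC \<cdot>\<^bsub>A_C2 n\<^esub> xC)"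
  shows "infinitesimal_R_matrix A (R_C2 q \<cdot>\<^bsub>tensor2 A\<^esub> (unit_el A \<otimes> unit_el A + a \<odot> Y)) (c \<odot> Y)"
proof -
  let ?A = "A_C2 n :: (_, 'k) hopf_data"
  let ?gx = "gC \<cdot>\<^bsub>?A\<^esub> xC"
  let ?Y = "xC \<otimes> ?gx" and ?Z = "xC \<otimes> gC \<otimes> ?gx"
  have alg: "is_algebra ?A" by (rule A_C2_is_algebra)
  have x: "xC \<in> vecs ?A" "gC \<in> vecs ?A" "?gx \<in> vecs ?A" "unit_el ?A \<in> vecs ?A"
    using is_algebraD(2)[OF alg, of gC xC] is_algebraD(1)[OF alg]
    by (auto simp: gC_hC_xC gh_vecs vecs_bvec A_C2_Basis C2_power_closed)
  have gx: "?gx = bvec ((1, 0, 1), 0)"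
    by (simp add: gC_hC_xC gh_def amult_lin A_C2_bmult)
  have gx2: "?gx \<cdot>\<^bsub>?A\<^esub> ?gx = 0"
    by (simp add: gx amult_lin A_C2_bmult)
  have comult: "comult ?A xC = unit_el ?A \<otimes> xC + xC \<otimes> gC" "comult ?A ?gx = gC \<otimes> ?gx + ?gx \<otimes> unit_el ?A"
    by (simp_all only: gx) (simp_all add: gC_hC_xC gh_def comult_def A_C2_bcomult A_C2_unit tens_lin)
  have "?Y \<cdot>\<^bsub>tensor2 ?A\<^esub> comult ?A v = comult ?A v \<cdot>\<^bsub>tensor2 ?A\<^esub> ?Y" if v: "v \<in> vecs ?A" for v
  proof -
    \<comment> \<open>For group-like \<open>b\<close> the signs from the two legs of
      \<open>?Y\<close> cancel. If \<open>b\<close> contains \<open>xC\<close>, both sides vanish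
      because every term has a leg with two factors \<open>xC\<close>.\<close>
    have "?Y \<cdot>\<^bsub>tensor2 ?A\<^esub> bcomult ?A b = bcomult ?A b \<cdot>\<^bsub>tensor2 ?A\<^esub> ?Y" if "b \<in> Basis ?A" for b
      unfolding gx using that
      by (auto simp: A_C2_Basis gC_hC_xC A_C2_bcomult tens_lin amult_lin tensor2_def tensor_alg_simps A_C2_bmult)
    then have "lin (\<lambda>b. ?Y \<cdot>\<^bsub>tensor2 ?A\<^esub> bcomult ?A b) v = lin (\<lambda>b. bcomult ?A b \<cdot>\<^bsub>tensor2 ?A\<^esub> ?Y) v"
      by (rule lin_cong_vecs[OF v])
    then show ?thesis
      by (simp add: comult_def lin_def amult_sum amult_lin(3,4))
  qed
  moreover have "?Z \<in> vecs (tensor3 ?A)" "?Y \<in> vecs (tensor2 ?A)"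
    unfolding tensor2_def tensor3_def by (intro tens_vecs x)+
  \<comment> \<open>Products with the 12 leg die in the first tensor position, by
    \<open>xC_xC\<close>, and those with the 23 leg in the third, by \<open>gx2\<close>.\<close>
  moreover have "?Y \<cdot>\<^bsub>tensor2 ?A\<^esub> ?Y = 0" "leg12 ?A ?Y \<cdot>\<^bsub>tensor3 ?A\<^esub> ?Z = 0" "?Z \<cdot>\<^bsub>tensor3 ?A\<^esub> leg12 ?A ?Y = 0"
    "leg23 ?A ?Y \<cdot>\<^bsub>tensor3 ?A\<^esub> ?Z = 0" "?Z \<cdot>\<^bsub>tensor3 ?A\<^esub> leg23 ?A ?Y = 0"
    by (simp_all add: tensor2_def tensor3_def leg_simps amult_tens xC_xC gx2 tens_lin)
  moreover have "id_tens_comult ?A ?Y = leg12 ?A ?Y + ?Z" "comult_tens_id ?A ?Y = leg23 ?A ?Y + ?Z"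
    by (simp_all add: comult_tens_simps comult leg_simps reassoc_simps tens_lin)
  ultimately show ?thesis
    unfolding A_def Y_def
    by (intro infinitesimal_R_matrix_deformation[where Z = ?Z and W = ?Z] quasitriangular_R_C2
        R_C2_xC(3,4) assms)
qed

theorem proposition4p7:
  fixes a \<alpha> :: "'k::field" and n q :: nat
  assumes "CHAR('k) \<noteq> 2" and "n \<ge> 2" and "q \<in> {0, 1}"
  shows "infinitesimal_R_matrix (A_C2 n) (Ra n q a) (\<alpha> \<odot> (xC \<otimes> amult (A_C2 n) xC gC))"
proof -
  have "xC \<cdot>\<^bsub>A_C2 n\<^esub> gC = - (gC \<cdot>\<^bsub>A_C2 n\<^esub> xC :: _ \<Rightarrow>\<^sub>0 'k)"
    by (simp add: gC_hC_xC gh_def amult_lin A_C2_bmult)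
  then show ?thesis
    using infinitesimal_R_matrix_R_C2[OF assms(1,3), of n a "- \<alpha>"] by (simp add: Ra_def Rq_eq tens_lin)
qed

end
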